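(* With the coaction $\delta$, $(\mathcal{H}_{\mathcal{G}},m,\Delta)$ and $(\mathcal{H}_{\mathcal{G}},m,\delta)$ are in cointeraction, that is to say $(\mathcal{H}_{\mathcal{G}},m,\Delta)$ is a Hopf algebra in the category of $(\mathcal{H}_{\mathcal{G}},m,\delta)$-comodules. In other words: \begin{itemize} \item $\delta(1)=1\otimes 1$. \item $m_{1,3,24}\circ(\delta\otimes\delta)\circ\Delta=(\Delta\otimes \mathrm{Id})\circ\delta$, where $m_{1,3,24}:\mathcal{H}_{\mathcal{G}}^{\otimes 4}\to\mathcal{H}_{\mathcal{G}}^{\otimes 3}$ is the linear map $a_1\otimes b_1\otimes a_2\otimes b_2\mapsto a_1\otimes a_2\otimes b_1b_2$. \item For all $a,b\in\mathcal{H}_{\mathcal{G}}$, $\delta(ab)=\delta(a)\delta(b)$. \item For all $a\in\mathcal{H}_{\mathcal{G}}$, $(\varepsilon\otimes\mathrm{Id})\circ\delta(a)=\varepsilon(a)1$. \end{itemize}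
   Context: A graph is a pair $G=(V(G),E(G))$ with $V(G)$ a finite set and $E(G)$ a set of $2$-element subsets of $V(G)$; graphs are considered up to isomorphism. The empty graph is denoted $1$ and is considered as non connected. For $I\subseteq V(G)$, $G_{|I}$ is the induced subgraph on $I$. For an equivalence relation $\sim$ on $V(G)$: $G/\sim$ is the graph with vertex set $V(G)/\sim$ and with an edge between two distinct classes if and only if some edge of $G$ joins an element of one to an element of the other; $G|\sim$ is the graph with $V(G|\sim)=V(G)$ and $E(G|\sim)=\{\{x,y\}\in E(G): x\sim y\}$; one writes $\sim\triangleleft G$ if $G_{|c}$ is connected for every class $c$ of $\sim$. $\mathcal{H}_{\mathcal{G}}$ is the $\mathbb{Q}$-vector space with basis the isoclasses of graphs; $m$ is the product given by disjoint union (unit $1$). The two coproducts are given, for any graph $G$, by $$\Delta(G)=\sum_{V(G)=I\sqcup J}G_{|I}\otimes G_{|J},\qquad \delta(G)=\sum_{\sim\triangleleft G}(G/\sim)\otimes(G|\sim).$$ The counit $\varepsilon$ of $\Delta$ sends the empty graph to $1$ and every nonempty graph to $0$. $(\mathcal{H}_{\mathcal{G}},m,\Delta)$ is a Hopf algebra and $(\mathcal{H}_{\mathcal{G}},m,\delta)$ is a bialgebra. *)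

theory Defs
  imports Complex_Main "HOL-Library.Poly_Mapping" "HOL-Library.Product_Plus"
begin

section \<open>Vector spaces with a basis, and their tensor products\<close>

text \<open>
  The rational vector space with basis \<open>'a\<close> is the type of finitely supported functions
  \<open>'a \<Rightarrow>\<^sub>0 rat\<close>, and the tensor product of the spaces with bases \<open>'a\<close> and \<open>'b\<close>
  is the space with basis \<open>'a \<times> 'b\<close>.  If \<open>'a\<close> is a commutative monoid (written additively),
  the library product on \<open>'a \<Rightarrow>\<^sub>0 rat\<close> is the bilinear extension of the monoid operation,
  and on \<open>'a \<times> 'b \<Rightarrow>\<^sub>0 rat\<close>, with componentwise addition of pairs, it is the product
  \<open>(a \<otimes> b)(c \<otimes> d) = ac \<otimes> bd\<close> of the tensor product algebra.
\<close>

type_synonym 'a free = "'a \<Rightarrow>\<^sub>0 rat"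

definition bas :: "'a \<Rightarrow> 'a free" where
  "bas a = Poly_Mapping.single a 1"

definition scale :: "rat \<Rightarrow> 'a free \<Rightarrow> 'a free" where
  "scale c x = Poly_Mapping.map ((*) c) x"

definition lin_ext :: "('a \<Rightarrow> 'b free) \<Rightarrow> 'a free \<Rightarrow> 'b free" where
  "lin_ext f x = (\<Sum>a\<in>Poly_Mapping.keys x. scale (Poly_Mapping.lookup x a) (f a))"

definition tensor :: "'a free \<Rightarrow> 'b free \<Rightarrow> ('a \<times> 'b) free" (infixr "\<otimes>" 75) where
  "x \<otimes> y = (\<Sum>a\<in>Poly_Mapping.keys x. \<Sum>b\<in>Poly_Mapping.keys y.
     scale (Poly_Mapping.lookup x a * Poly_Mapping.lookup y b) (bas (a, b)))"

definition tmap :: "('a free \<Rightarrow> 'c free) \<Rightarrow> ('b free \<Rightarrow> 'd free) \<Rightarrow> ('a \<times> 'b) free \<Rightarrow> ('c \<times> 'd) free" where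
  "tmap f g = lin_ext (\<lambda>(a, b). f (bas a) \<otimes> g (bas b))"

text \<open>\<open>\<phi> \<otimes> Id\<close> and \<open>Id \<otimes> \<phi>\<close> for a linear form \<open>\<phi>\<close>, with the scalar factor absorbed.\<close>

definition form_id :: "('a free \<Rightarrow> rat) \<Rightarrow> ('a \<times> 'b) free \<Rightarrow> 'b free" where
  "form_id \<phi> = lin_ext (\<lambda>(a, b). scale (\<phi> (bas a)) (bas b))"

definition id_form :: "('b free \<Rightarrow> rat) \<Rightarrow> ('a \<times> 'b) free \<Rightarrow> 'a free" where
  "id_form \<phi> = lin_ext (\<lambda>(a, b). scale (\<phi> (bas b)) (bas a))"

definition assoc :: "(('a \<times> 'b) \<times> 'c) free \<Rightarrow> ('a \<times> 'b \<times> 'c) free" where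
  "assoc = lin_ext (\<lambda>((a, b), c). bas a \<otimes> bas b \<otimes> bas c)"

definition mult :: "('a::comm_monoid_add \<times> 'a) free \<Rightarrow> 'a free" where
  "mult = lin_ext (\<lambda>(a, b). bas a * bas b)"

definition m_1_3_24 :: "(('a \<times> 'b::comm_monoid_add) \<times> ('c \<times> 'b)) free \<Rightarrow> (('a \<times> 'c) \<times> 'b) free" where
  "m_1_3_24 = lin_ext (\<lambda>((a\<^sub>1, b\<^sub>1), (a\<^sub>2, b\<^sub>2)). (bas a\<^sub>1 \<otimes> bas a\<^sub>2) \<otimes> (bas b\<^sub>1 * bas b\<^sub>2))"

abbreviation linear_map :: "('a free \<Rightarrow> 'b free) \<Rightarrow> bool" where
  "linear_map \<equiv> Vector_Spaces.linear scale scale"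

abbreviation linear_form :: "('a free \<Rightarrow> rat) \<Rightarrow> bool" where
  "linear_form \<equiv> Vector_Spaces.linear scale (*)"


section \<open>Bialgebras, Hopf algebras and comodules\<close>

definition coalgebra :: "('a free \<Rightarrow> ('a \<times> 'a) free) \<Rightarrow> ('a free \<Rightarrow> rat) \<Rightarrow> bool" where
  "coalgebra D e \<longleftrightarrow> linear_map D \<and> linear_form e \<and>
     (\<forall>x. assoc (tmap D id (D x)) = tmap id D (D x)) \<and>
     (\<forall>x. form_id e (D x) = x) \<and> (\<forall>x. id_form e (D x) = x)"

definition bialgebra :: "('a::comm_monoid_add free \<Rightarrow> ('a \<times> 'a) free) \<Rightarrow> ('a free \<Rightarrow> rat) \<Rightarrow> bool" where
  "bialgebra D e \<longleftrightarrow> coalgebra D e \<and>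
     D 1 = 1 \<otimes> 1 \<and> (\<forall>x y. D (x * y) = D x * D y) \<and>
     e 1 = 1 \<and> (\<forall>x y. e (x * y) = e x * e y)"

definition antipode :: "('a::comm_monoid_add free \<Rightarrow> ('a \<times> 'a) free) \<Rightarrow> ('a free \<Rightarrow> rat) \<Rightarrow>
    ('a free \<Rightarrow> 'a free) \<Rightarrow> bool" where
  "antipode D e S \<longleftrightarrow> linear_map S \<and>
     (\<forall>x. mult (tmap S id (D x)) = scale (e x) 1) \<and>
     (\<forall>x. mult (tmap id S (D x)) = scale (e x) 1)"

text \<open>The right comodules over the coalgebra with coproduct \<open>d\<close> and counit \<open>e\<close>.\<close>

definition comodule :: "('b free \<Rightarrow> ('b \<times> 'b) free) \<Rightarrow> ('b free \<Rightarrow> rat) \<Rightarrow>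
    ('a free \<Rightarrow> ('a \<times> 'b) free) \<Rightarrow> bool" where
  "comodule d e \<rho> \<longleftrightarrow> linear_map \<rho> \<and>
     (\<forall>x. assoc (tmap \<rho> id (\<rho> x)) = tmap id d (\<rho> x)) \<and> (\<forall>x. id_form e (\<rho> x) = x)"

definition comodule_hom :: "('a free \<Rightarrow> ('a \<times> 'b) free) \<Rightarrow> ('c free \<Rightarrow> ('c \<times> 'b) free) \<Rightarrow>
    ('a free \<Rightarrow> 'c free) \<Rightarrow> bool" where
  "comodule_hom \<rho> \<sigma> f \<longleftrightarrow> linear_map f \<and> (\<forall>x. \<sigma> (f x) = tmap f id (\<rho> x))"

text \<open>
  The monoidal structure of the category of comodules over a bialgebra: the coaction of a tensor
  product, and the unit object, the ground field (here \<open>unit free\<close>) with its trivial coaction.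
\<close>

definition tensor_coaction :: "('a free \<Rightarrow> ('a \<times> 'b::comm_monoid_add) free) \<Rightarrow>
    ('c free \<Rightarrow> ('c \<times> 'b) free) \<Rightarrow> ('a \<times> 'c) free \<Rightarrow> (('a \<times> 'c) \<times> 'b) free" where
  "tensor_coaction \<rho> \<sigma> = m_1_3_24 \<circ> tmap \<rho> \<sigma>"

definition trivial_coaction :: "unit free \<Rightarrow> (unit \<times> 'b::comm_monoid_add) free" where
  "trivial_coaction x = x \<otimes> 1"

definition unit_map :: "unit free \<Rightarrow> 'a::comm_monoid_add free" where
  "unit_map x = scale (Poly_Mapping.lookup x ()) 1"

definition counit_map :: "('a free \<Rightarrow> rat) \<Rightarrow> 'a free \<Rightarrow> unit free" where
  "counit_map e x = scale (e x) (bas ())"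

text \<open>
  The algebra \<open>'a free\<close> with coproduct \<open>D\<close>, counit \<open>e\<close> and coaction \<open>\<rho>\<close> is a Hopf algebra in the
  category of right comodules over the bialgebra \<open>'b free\<close> with coproduct \<open>d\<close> and counit \<open>e'\<close>:
  it is a Hopf algebra and a comodule, and all its structure maps are comodule morphisms.
\<close>

definition hopf_algebra_in_comodules ::
   "('b::comm_monoid_add free \<Rightarrow> ('b \<times> 'b) free) \<Rightarrow> ('b free \<Rightarrow> rat) \<Rightarrow>
    ('a::comm_monoid_add free \<Rightarrow> ('a \<times> 'b) free) \<Rightarrow>
    ('a free \<Rightarrow> ('a \<times> 'a) free) \<Rightarrow> ('a free \<Rightarrow> rat) \<Rightarrow> bool" where
  "hopf_algebra_in_comodules d e' \<rho> D e \<longleftrightarrow>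
     bialgebra d e' \<and> comodule d e' \<rho> \<and> bialgebra D e \<and>
     comodule_hom trivial_coaction \<rho> unit_map \<and>
     comodule_hom (tensor_coaction \<rho> \<rho>) \<rho> mult \<and>
     comodule_hom \<rho> trivial_coaction (counit_map e) \<and>
     comodule_hom \<rho> (tensor_coaction \<rho> \<rho>) D \<and>
     (\<exists>S. antipode D e S \<and> comodule_hom \<rho> \<rho> S)"


section \<open>Graphs\<close>

type_synonym 'a graph = "'a set \<times> 'a set set"

abbreviation verts :: "'a graph \<Rightarrow> 'a set" where "verts \<equiv> fst"
abbreviation edges :: "'a graph \<Rightarrow> 'a set set" where "edges \<equiv> snd"

definition is_graph :: "'a graph \<Rightarrow> bool" where
  "is_graph G \<longleftrightarrow> finite (verts G) \<and> edges G \<subseteq> {e. e \<subseteq> verts G \<and> card e = 2}"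

definition iso_by :: "('a \<Rightarrow> 'b) \<Rightarrow> 'a graph \<Rightarrow> 'b graph \<Rightarrow> bool" where
  "iso_by f G H \<longleftrightarrow> bij_betw f (verts G) (verts H) \<and> edges H = (\<lambda>e. f ` e) ` edges G"

definition isomorphic :: "'a graph \<Rightarrow> 'b graph \<Rightarrow> bool" where
  "isomorphic G H \<longleftrightarrow> (\<exists>f. iso_by f G H)"

definition induced :: "'a graph \<Rightarrow> 'a set \<Rightarrow> 'a graph" where
  "induced G I = (I, {e \<in> edges G. e \<subseteq> I})"

definition disj_union :: "'a graph \<Rightarrow> 'b graph \<Rightarrow> ('a + 'b) graph" where
  "disj_union G H = (verts G <+> verts H,
     (\<lambda>e. Inl ` e) ` edges G \<union> (\<lambda>e. Inr ` e) ` edges H)"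

definition connected_graph :: "'a graph \<Rightarrow> bool" where
  "connected_graph G \<longleftrightarrow> verts G \<noteq> {} \<and>
     (\<forall>x\<in>verts G. \<forall>y\<in>verts G. (x, y) \<in> {(u, v). {u, v} \<in> edges G}\<^sup>*)"

text \<open>For an equivalence relation \<open>r\<close> on the vertices, \<open>contract G r\<close> is \<open>G/r\<close>, \<open>cut G r\<close> is \<open>G|r\<close>,
  and \<open>r \<in> admissible G\<close> is the relation \<open>r \<triangleleft> G\<close>.\<close>

definition contract :: "'a graph \<Rightarrow> 'a rel \<Rightarrow> 'a set graph" where
  "contract G r = (verts G // r,
     {{c, d} |c d. c \<in> verts G // r \<and> d \<in> verts G // r \<and> c \<noteq> d \<and>
        (\<exists>x\<in>c. \<exists>y\<in>d. {x, y} \<in> edges G)})"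

definition cut :: "'a graph \<Rightarrow> 'a rel \<Rightarrow> 'a graph" where
  "cut G r = (verts G, {{x, y} |x y. {x, y} \<in> edges G \<and> (x, y) \<in> r})"

definition admissible :: "'a graph \<Rightarrow> 'a rel set" where
  "admissible G = {r. equiv (verts G) r \<and> (\<forall>c\<in>verts G // r. connected_graph (induced G c))}"


subsection \<open>Isomorphism classes\<close>

lemma iso_by_refl: "iso_by id G G"
  by (simp add: iso_by_def)

lemma iso_by_trans:
  assumes "iso_by f G H" "iso_by g H K"
  shows "iso_by (g \<circ> f) G K"
  using assms by (auto simp: iso_by_def image_image image_comp intro: bij_betw_trans)

lemma edges_subset: "is_graph G \<Longrightarrow> e \<in> edges G \<Longrightarrow> e \<subseteq> verts G"
  by (auto simp: is_graph_def)

lemma iso_by_sym: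
  assumes "iso_by f G H" "is_graph G"
  shows "iso_by (inv_into (verts G) f) H G"
proof -
  have b: "bij_betw f (verts G) (verts H)" and E: "edges H = (\<lambda>e. f ` e) ` edges G"
    using assms by (auto simp: iso_by_def)
  have "inv_into (verts G) f ` f ` e = e" if "e \<in> edges G" for e
    using edges_subset[OF assms(2) that] b by (simp add: bij_betw_def inv_into_image_cancel)
  then show ?thesis
    using b by (auto simp: iso_by_def E image_image bij_betw_inv_into image_iff)
qed

lemma iso_by_is_graph:
  assumes "iso_by f G H" "is_graph G"
  shows "is_graph H"
proof -
  have b: "bij_betw f (verts G) (verts H)" and E: "edges H = (\<lambda>e. f ` e) ` edges G"
    using assms by (auto simp: iso_by_def)
  have "f ` e \<subseteq> verts H \<and> card (f ` e) = 2" if "e \<in> edges G" for e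
  proof -
    have e: "e \<subseteq> verts G" "card e = 2"
      using that assms(2) by (auto simp: is_graph_def)
    then have "inj_on f e" using b inj_on_subset by (auto simp: bij_betw_def)
    then show ?thesis using e b by (auto simp: card_image bij_betw_def)
  qed
  then show ?thesis
    using b assms(2) by (auto simp: is_graph_def E bij_betw_finite)
qed

lemma isomorphic_refl: "isomorphic G G"
  using iso_by_refl isomorphic_def by blast

lemma isomorphic_trans: "isomorphic G H \<Longrightarrow> isomorphic H K \<Longrightarrow> isomorphic G K"
  unfolding isomorphic_def using iso_by_trans by blast

lemma isomorphic_sym: "isomorphic G H \<Longrightarrow> is_graph G \<Longrightarrow> isomorphic H G"
  unfolding isomorphic_def using iso_by_sym by blast

text \<open>
  Every finite graph has an isomorphic copy with vertices in \<open>nat\<close>, so the isoclasses of all graphs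
  are represented by the isoclasses of graphs on \<open>nat\<close>.
\<close>

quotient_type isograph =
  "nat graph" / partial: "\<lambda>G H. is_graph G \<and> is_graph H \<and> isomorphic G H"
proof (rule part_equivpI)
  show "\<exists>G::nat graph. is_graph G \<and> is_graph G \<and> isomorphic G G"
    by (rule exI[of _ "({}, {})"]) (simp add: is_graph_def isomorphic_refl)
  show "symp (\<lambda>(G::nat graph) H. is_graph G \<and> is_graph H \<and> isomorphic G H)"
    by (auto intro!: sympI intro: isomorphic_sym)
  show "transp (\<lambda>(G::nat graph) H. is_graph G \<and> is_graph H \<and> isomorphic G H)"
    by (auto intro!: transpI intro: isomorphic_trans)
qed

definition isoclass :: "'a graph \<Rightarrow> isograph" where
  "isoclass G = abs_isograph (SOME H. is_graph H \<and> isomorphic G H)"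

lemma ex_nat_graph:
  assumes "is_graph G"
  shows "\<exists>H::nat graph. is_graph H \<and> isomorphic G H"
proof -
  obtain f :: "'a \<Rightarrow> nat" where f: "inj_on f (verts G)"
    using assms finite_imp_inj_to_nat_seg[of "verts G"] unfolding is_graph_def by metis
  have "iso_by f G (f ` verts G, (\<lambda>e. f ` e) ` edges G)"
    using f by (auto simp: iso_by_def bij_betw_def)
  then show ?thesis
    using iso_by_is_graph[OF _ assms] unfolding isomorphic_def by metis
qed

lemma abs_isograph_eq_iff:
  assumes "is_graph G" "is_graph H"
  shows "abs_isograph G = abs_isograph H \<longleftrightarrow> isomorphic G H"
  using Quotient3_rel[OF Quotient3_isograph, of G H] assms isomorphic_refl by blast

lemma isoclass_ex:
  assumes "is_graph G"
  shows "\<exists>H. is_graph H \<and> isomorphic G H \<and> isoclass G = abs_isograph H"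
  using someI_ex[OF ex_nat_graph[OF assms]] unfolding isoclass_def by blast

lemma isoclass_eq_iff:
  assumes "is_graph G" "is_graph H"
  shows "isoclass G = isoclass H \<longleftrightarrow> isomorphic G H"
proof -
  obtain G' where G': "is_graph G'" "isomorphic G G'" "isoclass G = abs_isograph G'"
    using isoclass_ex[OF assms(1)] by blast
  obtain H' where H': "is_graph H'" "isomorphic H H'" "isoclass H = abs_isograph H'"
    using isoclass_ex[OF assms(2)] by blast
  show ?thesis
    unfolding G'(3) H'(3) abs_isograph_eq_iff[OF G'(1) H'(1)]
  proof
    assume "isomorphic G' H'"
    then show "isomorphic G H"
      using isomorphic_trans[OF G'(2) isomorphic_trans] isomorphic_sym[OF H'(2) assms(2)] by blast
  next
    assume "isomorphic G H"
    then show "isomorphic G' H'"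
      using isomorphic_trans[OF isomorphic_sym[OF G'(2) assms(1)] isomorphic_trans] H'(2) by blast
  qed
qed

lemma isoclass_nat: "is_graph G \<Longrightarrow> isoclass G = abs_isograph G"
  by (metis abs_isograph_eq_iff isoclass_ex)

lemma isoclass_cases:
  obtains G :: "nat graph" where "is_graph G" "C = isoclass G"
proof (rule that)
  show "is_graph (rep_isograph C)"
    using Quotient3_rep_reflp[OF Quotient3_isograph, of C] by simp
  then show "C = isoclass (rep_isograph C)"
    using Quotient3_abs_rep[OF Quotient3_isograph, of C] by (simp add: isoclass_nat)
qed

lemma is_graph_disj_union:
  assumes "is_graph G" "is_graph H"
  shows "is_graph (disj_union G H)"
  using assms by (fastforce simp: is_graph_def disj_union_def card_image)

lemma isomorphic_disj_union:
  assumes "isomorphic G G'" "isomorphic H H'"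
  shows "isomorphic (disj_union G H) (disj_union G' H')"
proof -
  obtain f g where f: "iso_by f G G'" and g: "iso_by g H H'"
    using assms by (auto simp: isomorphic_def)
  have "bij_betw (map_sum f g) (verts G <+> verts H) (verts G' <+> verts H')"
  proof -
    have im: "verts G' = f ` verts G" "verts H' = g ` verts H"
      and inj: "inj_on f (verts G)" "inj_on g (verts H)"
      using f g by (auto simp: iso_by_def bij_betw_def)
    have "inj_on (map_sum f g) (verts G <+> verts H)"
      using inj by (fastforce intro!: inj_onI dest: inj_onD)
    then show ?thesis
      by (simp add: bij_betw_def im Plus_def image_Un image_image)
  qed
  then have "iso_by (map_sum f g) (disj_union G H) (disj_union G' H')"
    using f g by (simp add: iso_by_def disj_union_def image_Un image_image)
  then show ?thesis by (auto simp: isomorphic_def)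
qed

text \<open>Isoclasses form a commutative monoid for disjoint union, which makes \<open>isograph free\<close>
  an algebra with product \<open>m\<close> and unit the empty graph.\<close>

instantiation isograph :: comm_monoid_add
begin

definition zero_isograph :: isograph where
  "zero_isograph = isoclass (({}, {}) :: nat graph)"

lift_definition plus_isograph :: "isograph \<Rightarrow> isograph \<Rightarrow> isograph" is
  "\<lambda>G H. isoclass (disj_union G H)"
  by (simp add: isoclass_eq_iff is_graph_disj_union isomorphic_disj_union)

lemma isoclass_plus:
  assumes "is_graph G" "is_graph H"
  shows "isoclass G + isoclass H = isoclass (disj_union G H)"
proof -
  obtain G' where G': "is_graph G'" "isomorphic G G'" "isoclass G = abs_isograph G'"
    using isoclass_ex[OF assms(1)] by blast
  obtain H' where H': "is_graph H'" "isomorphic H H'" "isoclass H = abs_isograph H'"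
    using isoclass_ex[OF assms(2)] by blast
  have "abs_isograph G' + abs_isograph H' = isoclass (disj_union G' H')"
    by (rule plus_isograph.abs_eq) (simp_all add: G' H' isomorphic_refl)
  also have "\<dots> = isoclass (disj_union G H)"
    using isomorphic_disj_union[OF isomorphic_sym[OF G'(2) assms(1)] isomorphic_sym[OF H'(2) assms(2)]]
    by (simp add: isoclass_eq_iff is_graph_disj_union assms G'(1) H'(1))
  finally show ?thesis using G' H' by simp
qed

instance
proof
  fix A B C :: isograph
  obtain G :: "nat graph" where G: "is_graph G" "A = isoclass G" by (rule isoclass_cases)
  obtain H :: "nat graph" where H: "is_graph H" "B = isoclass H" by (rule isoclass_cases)
  obtain K :: "nat graph" where K: "is_graph K" "C = isoclass K" by (rule isoclass_cases)
  let ?a = "case_sum (case_sum Inl (Inr \<circ> Inl)) (Inr \<circ> Inr)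
    :: (nat + nat) + nat \<Rightarrow> nat + (nat + nat)"
  have "bij_betw ?a ((verts G <+> verts H) <+> verts K) (verts G <+> (verts H <+> verts K))"
    by (auto simp: bij_betw_def inj_on_def Plus_def image_Un image_image)
  then have "iso_by ?a (disj_union (disj_union G H) K) (disj_union G (disj_union H K))"
    by (simp add: iso_by_def disj_union_def image_Un image_image Un_assoc)
  then show "A + B + C = A + (B + C)"
    unfolding G H K using G H K
    by (auto simp: isoclass_plus is_graph_disj_union isoclass_eq_iff isomorphic_def)
  let ?s = "case_sum Inr Inl :: nat + nat \<Rightarrow> nat + nat"
  have "bij_betw ?s (verts G <+> verts H) (verts H <+> verts G)"
    by (auto simp: bij_betw_def inj_on_def Plus_def image_Un image_image)
  then have "iso_by ?s (disj_union G H) (disj_union H G)"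
    by (simp add: iso_by_def disj_union_def image_Un image_image Un_commute)
  then show "A + B = B + A"
    unfolding G H using G H
    by (auto simp: isoclass_plus is_graph_disj_union isoclass_eq_iff isomorphic_def)
  have e: "is_graph (({}, {}) :: nat graph)" by (simp add: is_graph_def)
  have "iso_by (case_sum id id) (disj_union (({}, {}) :: nat graph) G) G"
    unfolding iso_by_def disj_union_def
    by (auto simp: Plus_def image_image bij_betw_def inj_on_def)
  then show "0 + A = A"
    unfolding G zero_isograph_def using G e
    by (auto simp: isoclass_plus is_graph_disj_union isoclass_eq_iff isomorphic_def)
qed

end


section \<open>The two coproducts\<close>

type_synonym HG = "isograph free"

definition Delta_sum :: "'a graph \<Rightarrow> (isograph \<times> isograph) free" where
  "Delta_sum G = (\<Sum>(I, J)\<in>{(I, J). I \<union> J = verts G \<and> I \<inter> J = {}}.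
     bas (isoclass (induced G I)) \<otimes> bas (isoclass (induced G J)))"

definition delta_sum :: "'a graph \<Rightarrow> (isograph \<times> isograph) free" where
  "delta_sum G = (\<Sum>r\<in>admissible G.
     bas (isoclass (contract G r)) \<otimes> bas (isoclass (cut G r)))"

lemma is_graph_induced: "is_graph G \<Longrightarrow> I \<subseteq> verts G \<Longrightarrow> is_graph (induced G I)"
  by (auto simp: is_graph_def induced_def intro: finite_subset)

lemma is_graph_contract:
  assumes "is_graph G" "equiv (verts G) r"
  shows "is_graph (contract G r)"
proof -
  have "finite (verts G // r)"
    using assms by (auto simp: is_graph_def equiv_def intro!: finite_quotient)
  moreover have "card {c, d} = 2" if "c \<noteq> d" for c d :: "'a set"
    using that by simp
  ultimately show ?thesis
    unfolding is_graph_def contract_def fst_conv snd_conv by blast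
qed

lemma is_graph_cut: "is_graph G \<Longrightarrow> is_graph (cut G r)"
  by (auto simp: is_graph_def cut_def)

lemma iso_by_induced:
  assumes "iso_by f G H" "is_graph G" "I \<subseteq> verts G"
  shows "iso_by f (induced G I) (induced H (f ` I))"
proof -
  have inj: "inj_on f (verts G)" and E: "edges H = (\<lambda>e. f ` e) ` edges G"
    using assms(1) by (auto simp: iso_by_def bij_betw_def)
  have "f ` e \<subseteq> f ` I \<longleftrightarrow> e \<subseteq> I" if "e \<in> edges G" for e
    using inj edges_subset[OF assms(2) that] assms(3) by (blast dest: inj_onD)
  then have "{e \<in> edges H. e \<subseteq> f ` I} = (\<lambda>e. f ` e) ` {e \<in> edges G. e \<subseteq> I}"
    unfolding E by (auto 0 4 simp: image_iff)
  then show ?thesis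
    using inj assms(3) by (auto simp: iso_by_def induced_def bij_betw_def inj_on_subset)
qed

lemma Delta_sum_iso:
  assumes "isomorphic G H" "is_graph G"
  shows "Delta_sum G = Delta_sum H"
proof -
  obtain f where f: "iso_by f G H" using assms by (auto simp: isomorphic_def)
  have H: "is_graph H" by (rule iso_by_is_graph[OF f assms(2)])
  have b: "bij_betw f (verts G) (verts H)" using f by (simp add: iso_by_def)
  have inj: "inj_on f (verts G)" and im: "f ` verts G = verts H"
    using b by (auto simp: bij_betw_def)
  let ?P = "\<lambda>G. {(I, J). I \<union> J = verts G \<and> I \<inter> J = {}}"
  let ?g = "inv_into (verts G) f"
  have inv: "iso_by ?g H G" by (rule iso_by_sym[OF f assms(2)])
  then have ginj: "inj_on ?g (verts H)" and gim: "?g ` verts H = verts G"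
    by (auto simp: iso_by_def bij_betw_def)
  have gf: "?g ` f ` I = I" if "I \<subseteq> verts G" for I
    using that inj by (rule inv_into_image_cancel[rotated])
  have fg: "f ` ?g ` I = I" if "I \<subseteq> verts H" for I
    using that im by (simp add: image_inv_into_cancel)
  have eq: "isoclass (induced H (f ` I)) = isoclass (induced G I)" if "I \<subseteq> verts G" for I
  proof -
    have "f ` I \<subseteq> verts H" using that im by blast
    then have "is_graph (induced H (f ` I))" "is_graph (induced G I)"
      using is_graph_induced H assms(2) that by blast+
    moreover have "isomorphic (induced G I) (induced H (f ` I))"
      using iso_by_induced[OF f assms(2) that] isomorphic_def by blast
    ultimately show ?thesis using isoclass_eq_iff by metis
  qed
  show ?thesis
    unfolding Delta_sum_def
  proof (rule sum.reindex_bij_witness[where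
        i = "\<lambda>(I, J). (?g ` I, ?g ` J)" and j = "\<lambda>(I, J). (f ` I, f ` J)"])
    fix p assume "p \<in> ?P G"
    then obtain I J where p: "p = (I, J)" "I \<union> J = verts G" "I \<inter> J = {}" by auto
    then have IJ: "I \<subseteq> verts G" "J \<subseteq> verts G" by auto
    show "(case case p of (I, J) \<Rightarrow> (f ` I, f ` J) of (I, J) \<Rightarrow> (?g ` I, ?g ` J)) = p"
      using p(1) gf[OF IJ(1)] gf[OF IJ(2)] by simp
    have "f ` I \<union> f ` J = verts H" using p(2) im by blast
    moreover have "f ` I \<inter> f ` J = {}"
      using inj_on_image_Int[OF inj IJ] p(3) by simp
    ultimately show "(case p of (I, J) \<Rightarrow> (f ` I, f ` J)) \<in> ?P H"
      using p(1) by simp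
    show "(case case p of (I, J) \<Rightarrow> (f ` I, f ` J) of (I, J) \<Rightarrow>
        bas (isoclass (induced H I)) \<otimes> bas (isoclass (induced H J))) =
      (case p of (I, J) \<Rightarrow> bas (isoclass (induced G I)) \<otimes> bas (isoclass (induced G J)))"
      using p(1) eq[OF IJ(1)] eq[OF IJ(2)] by simp
  next
    fix p assume "p \<in> ?P H"
    then obtain I J where p: "p = (I, J)" "I \<union> J = verts H" "I \<inter> J = {}" by auto
    then have IJ: "I \<subseteq> verts H" "J \<subseteq> verts H" by auto
    show "(case case p of (I, J) \<Rightarrow> (?g ` I, ?g ` J) of (I, J) \<Rightarrow> (f ` I, f ` J)) = p"
      using p(1) fg[OF IJ(1)] fg[OF IJ(2)] by simp
    have "?g ` I \<union> ?g ` J = verts G" using p(2) gim by blast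
    moreover have "?g ` I \<inter> ?g ` J = {}"
      using inj_on_image_Int[OF ginj IJ] p(3) by simp
    ultimately show "(case p of (I, J) \<Rightarrow> (?g ` I, ?g ` J)) \<in> ?P G"
      using p(1) by simp
  qed
qed

lemma connected_graph_iso:
  assumes "iso_by f G H" "connected_graph G"
  shows "connected_graph H"
proof -
  have im: "f ` verts G = verts H" and E: "edges H = (\<lambda>e. f ` e) ` edges G"
    using assms(1) by (auto simp: iso_by_def bij_betw_def)
  have step: "(f x, f y) \<in> {(u, v). {u, v} \<in> edges H}\<^sup>*"
    if "(x, y) \<in> {(u, v). {u, v} \<in> edges G}\<^sup>*" for x y
    using that
  proof (induction rule: rtrancl_induct)
    case (step y z)
    then have "{f y, f z} \<in> edges H" unfolding E by (auto simp: image_iff intro!: bexI[of _ "{y, z}"])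
    then show ?case using step.IH by (auto intro: rtrancl_into_rtrancl)
  qed simp
  show ?thesis
    using assms(2) step unfolding connected_graph_def im[symmetric] by blast
qed

definition push :: "('a \<Rightarrow> 'b) \<Rightarrow> 'a rel \<Rightarrow> 'b rel" where
  "push f r = map_prod f f ` r"

lemma push_equiv:
  assumes "bij_betw f V W" "equiv V r"
  shows "equiv W (push f r)"
proof (rule equivI)
  have inj: "inj_on f V" and im: "f ` V = W" using assms(1) by (auto simp: bij_betw_def)
  have sub: "r \<subseteq> V \<times> V" and refl: "refl_on V r" and sym: "sym r" and trans: "trans r"
    using assms(2) by (auto elim: equivE)
  show "push f r \<subseteq> W \<times> W" using sub im by (auto simp: push_def)
  show "refl_on W (push f r)"
    using refl im by (force simp: push_def refl_on_def)
  show "sym (push f r)"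
    using sym by (force simp: push_def sym_def)
  show "trans (push f r)"
  proof (rule transI)
    fix x y z assume "(x, y) \<in> push f r" "(y, z) \<in> push f r"
    then obtain a b b' c where *: "(a, b) \<in> r" "(b', c) \<in> r" "x = f a" "y = f b" "y = f b'" "z = f c"
      by (auto simp: push_def)
    then have "b = b'" using inj sub by (meson SigmaE2 inj_onD subsetD)
    then have "(a, c) \<in> r" using * trans by (meson transD)
    then show "(x, z) \<in> push f r" using * by (force simp: push_def)
  qed
qed

lemma push_class:
  assumes "inj_on f V" "equiv V r" "x \<in> V"
  shows "push f r `` {f x} = f ` (r `` {x})"
proof -
  have "r \<subseteq> V \<times> V" using assms(2) by (rule equivE)
  then have "a = x" if "(a, b) \<in> r" "f a = f x" for a b
    using that assms(1,3) by (blast dest: inj_onD)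
  moreover have "push f r `` {f x} = {f b |b. \<exists>a. (a, b) \<in> r \<and> f a = f x}"
    by (force simp: push_def)
  ultimately show ?thesis by blast
qed

lemma push_quotient:
  assumes "bij_betw f V W" "equiv V r"
  shows "W // push f r = (\<lambda>c. f ` c) ` (V // r)"
proof -
  have inj: "inj_on f V" and im: "f ` V = W" using assms(1) by (auto simp: bij_betw_def)
  have "W // push f r = (\<lambda>x. push f r `` {f x}) ` V"
    by (auto simp: quotient_def im[symmetric])
  also have "\<dots> = (\<lambda>x. f ` (r `` {x})) ` V"
    using push_class[OF inj assms(2)] by (intro image_cong) auto
  also have "\<dots> = (\<lambda>c. f ` c) ` (V // r)"
    by (auto simp: quotient_def)
  finally show ?thesis .
qed

lemma quotient_subset: "equiv V r \<Longrightarrow> c \<in> V // r \<Longrightarrow> c \<subseteq> V"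
  by (auto elim!: equivE simp: quotient_def)

lemma push_admissible:
  assumes "iso_by f G H" "is_graph G" "r \<in> admissible G"
  shows "push f r \<in> admissible H"
proof -
  have b: "bij_betw f (verts G) (verts H)" using assms(1) by (simp add: iso_by_def)
  have eq: "equiv (verts G) r"
    and con: "\<And>c. c \<in> verts G // r \<Longrightarrow> connected_graph (induced G c)"
    using assms(3) by (auto simp: admissible_def)
  have "connected_graph (induced H (f ` c))" if "c \<in> verts G // r" for c
    using connected_graph_iso[OF iso_by_induced[OF assms(1,2) quotient_subset[OF eq that]] con[OF that]] .
  then show ?thesis
    using push_equiv[OF b eq] push_quotient[OF b eq] by (auto simp: admissible_def)
qed

lemma iso_edge_iff:
  assumes "iso_by f G H" "is_graph G" "x \<in> verts G" "y \<in> verts G"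
  shows "{f x, f y} \<in> edges H \<longleftrightarrow> {x, y} \<in> edges G"
proof -
  have inj: "inj_on f (verts G)" and E: "edges H = (\<lambda>e. f ` e) ` edges G"
    using assms(1) by (auto simp: iso_by_def bij_betw_def)
  have "e = {x, y}" if "e \<in> edges G" "f ` e = {f x, f y}" for e
  proof -
    have "f ` e = f ` {x, y}" using that(2) by simp
    then show ?thesis
      using inj_on_image_eq_iff[OF inj edges_subset[OF assms(2) that(1)], of "{x, y}"] assms by simp
  qed
  moreover have "{f x, f y} \<in> (\<lambda>e. f ` e) ` edges G" if "{x, y} \<in> edges G"
    using imageI[OF that, of "\<lambda>e. f ` e"] by simp
  ultimately show ?thesis unfolding E by (metis imageE)
qed

lemma image_Collect2: "g ` {h x y |x y. P x y} = {g (h x y) |x y. P x y}"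
  by blast

lemma push_cut:
  assumes "iso_by f G H" "is_graph G" "equiv (verts G) r"
  shows "iso_by f (cut G r) (cut H (push f r))"
proof -
  have b: "bij_betw f (verts G) (verts H)" using assms(1) by (simp add: iso_by_def)
  have sub: "r \<subseteq> verts G \<times> verts G" using assms(3) by (rule equivE)
  have "edges (cut H (push f r)) = {{f x, f y} |x y. {f x, f y} \<in> edges H \<and> (x, y) \<in> r}"
    by (force simp: cut_def push_def)
  also have "\<dots> = {{f x, f y} |x y. {x, y} \<in> edges G \<and> (x, y) \<in> r}"
    using iso_edge_iff[OF assms(1,2)] sub by (intro Collect_cong) blast
  also have "\<dots> = (\<lambda>e. f ` e) ` edges (cut G r)"
    by (simp add: cut_def image_Collect2)
  finally show ?thesis using b by (simp add: iso_by_def cut_def)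
qed

lemma push_contract:
  assumes "iso_by f G H" "is_graph G" "equiv (verts G) r"
  shows "iso_by (\<lambda>c. f ` c) (contract G r) (contract H (push f r))"
proof -
  have b: "bij_betw f (verts G) (verts H)" using assms(1) by (simp add: iso_by_def)
  then have inj: "inj_on f (verts G)" by (simp add: bij_betw_def)
  note Q = push_quotient[OF b assms(3)]
  note S = quotient_subset[OF assms(3)]
  have injQ: "inj_on (\<lambda>c. f ` c) (verts G // r)"
    using S inj by (auto intro!: inj_onI simp: inj_on_image_eq_iff)
  have E: "(\<exists>x\<in>f ` c. \<exists>y\<in>f ` d. {x, y} \<in> edges H) \<longleftrightarrow> (\<exists>x\<in>c. \<exists>y\<in>d. {x, y} \<in> edges G)"
    if "c \<in> verts G // r" "d \<in> verts G // r" for c d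
    using iso_edge_iff[OF assms(1,2)] S[OF that(1)] S[OF that(2)] by (auto simp: subset_iff) 
  have "edges (contract H (push f r)) =
    {{f ` c, f ` d} |c d. c \<in> verts G // r \<and> d \<in> verts G // r \<and> f ` c \<noteq> f ` d \<and>
        (\<exists>x\<in>f ` c. \<exists>y\<in>f ` d. {x, y} \<in> edges H)}"
    unfolding contract_def Q by (simp only: snd_conv) blast
  also have "\<dots> = {{f ` c, f ` d} |c d. c \<in> verts G // r \<and> d \<in> verts G // r \<and> c \<noteq> d \<and>
        (\<exists>x\<in>c. \<exists>y\<in>d. {x, y} \<in> edges G)}"
    using E inj_on_eq_iff[OF injQ] by (intro Collect_cong ex_cong1 conj_cong refl) auto
  also have "\<dots> = (\<lambda>e. (\<lambda>c. f ` c) ` e) ` edges (contract G r)"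
    by (simp add: contract_def image_Collect2)
  finally show ?thesis
    using injQ Q by (simp add: iso_by_def bij_betw_def contract_def)
qed

lemma push_push:
  assumes "\<And>x. x \<in> V \<Longrightarrow> g (f x) = x" "r \<subseteq> V \<times> V"
  shows "push g (push f r) = r"
proof -
  have "push g (push f r) = (\<lambda>p. p) ` r"
    unfolding push_def image_image using assms by (intro image_cong) auto
  then show ?thesis by simp
qed

lemma delta_sum_iso:
  assumes "isomorphic G H" "is_graph G"
  shows "delta_sum G = delta_sum H"
proof -
  obtain f where f: "iso_by f G H" using assms by (auto simp: isomorphic_def)
  have H: "is_graph H" by (rule iso_by_is_graph[OF f assms(2)])
  have b: "bij_betw f (verts G) (verts H)" using f by (simp add: iso_by_def)
  let ?g = "inv_into (verts G) f"
  have inv: "iso_by ?g H G" by (rule iso_by_sym[OF f assms(2)])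
  show ?thesis
    unfolding delta_sum_def
  proof (rule sum.reindex_bij_witness[where i = "push ?g" and j = "push f"])
    fix r assume r: "r \<in> admissible G"
    then have eq: "equiv (verts G) r" by (simp add: admissible_def)
    then have sub: "r \<subseteq> verts G \<times> verts G" by (rule equivE)
    show "push ?g (push f r) = r"
      using b sub by (intro push_push[of "verts G"]) (simp_all add: bij_betw_def)
    show "push f r \<in> admissible H" by (rule push_admissible[OF f assms(2) r])
    have eqH: "equiv (verts H) (push f r)" by (rule push_equiv[OF b eq])
    have "isoclass (contract G r) = isoclass (contract H (push f r))"
      using push_contract[OF f assms(2) eq] is_graph_contract[OF assms(2) eq]
        is_graph_contract[OF H eqH] by (auto simp: isoclass_eq_iff isomorphic_def)
    moreover have "isoclass (cut G r) = isoclass (cut H (push f r))"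
      using push_cut[OF f assms(2) eq] is_graph_cut[OF assms(2)]
        is_graph_cut[OF H] by (auto simp: isoclass_eq_iff isomorphic_def)
    ultimately show "bas (isoclass (contract H (push f r))) \<otimes> bas (isoclass (cut H (push f r))) =
        bas (isoclass (contract G r)) \<otimes> bas (isoclass (cut G r))" by simp
  next
    fix r assume r: "r \<in> admissible H"
    then have "equiv (verts H) r" by (simp add: admissible_def)
    then have sub: "r \<subseteq> verts H \<times> verts H" by (rule equivE)
    show "push f (push ?g r) = r"
      using b sub by (intro push_push[of "verts H"]) (simp_all add: bij_betw_def f_inv_into_f)
    show "push ?g r \<in> admissible G" by (rule push_admissible[OF inv H r])
  qed
qed

lift_definition Delta_basis :: "isograph \<Rightarrow> (isograph \<times> isograph) free" is Delta_sum
  using Delta_sum_iso by blast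

lift_definition delta_basis :: "isograph \<Rightarrow> (isograph \<times> isograph) free" is delta_sum
  using delta_sum_iso by blast

definition Delta :: "HG \<Rightarrow> (isograph \<times> isograph) free" where
  "Delta = lin_ext Delta_basis"

definition delta :: "HG \<Rightarrow> (isograph \<times> isograph) free" where
  "delta = lin_ext delta_basis"

definition eps :: "HG \<Rightarrow> rat" where
  "eps x = (\<Sum>C\<in>Poly_Mapping.keys x. Poly_Mapping.lookup x C * (if C = 0 then 1 else 0))"

lemma scale_1: "scale 1 x = x"
  unfolding scale_def by (rule poly_mapping_eqI) (simp add: Poly_Mapping.map.rep_eq when_def)

lemma lin_ext_bas: "lin_ext f (bas a) = f a"
  by (simp add: lin_ext_def bas_def scale_1)

text \<open>The defining formulas hold for graphs on an arbitrary vertex type.\<close>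

lemma Delta_isoclass:
  assumes "is_graph G"
  shows "Delta (bas (isoclass G)) = Delta_sum G"
proof -
  obtain H where "is_graph H" "isomorphic G H" "isoclass G = abs_isograph H"
    using isoclass_ex[OF assms] by blast
  then show ?thesis
    using Delta_sum_iso[OF _ assms, of H] by (simp add: Delta_def lin_ext_bas Delta_basis.abs_eq isomorphic_refl)
qed

lemma delta_isoclass:
  assumes "is_graph G"
  shows "delta (bas (isoclass G)) = delta_sum G"
proof -
  obtain H where "is_graph H" "isomorphic G H" "isoclass G = abs_isograph H"
    using isoclass_ex[OF assms] by blast
  then show ?thesis
    using delta_sum_iso[OF _ assms, of H] by (simp add: delta_def lin_ext_bas delta_basis.abs_eq isomorphic_refl)
qed

end

theory Submission
  imports Defs
begin

text \<open>
  All maps in the statement are linear and all products bilinear, so every identity is checked on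
  isoclasses of graphs, where the two sides become sums over combinatorial data.  Each identity then
  comes from a bijection between the two index sets.

  \<^item> Cointeraction.  A splitting of the vertices of \<open>G\<close> into \<open>I\<close> and \<open>J\<close> together with
  admissible relations on the two parts is the same as an admissible relation \<open>t\<close> on \<open>G\<close> (the union
  of the two) together with a splitting of the set of classes of \<open>t\<close>.  Under this bijection \<open>I\<close> is a
  union of classes (\<open>saturated t I\<close>), contraction and cutting commute with restriction to \<open>I\<close>
  (\<open>induced_contract\<close>, \<open>induced_cut\<close>), and no edge of \<open>G|t\<close> joins \<open>I\<close> to \<open>J\<close>, so that \<open>G|t\<close> is the product
  of its two restrictions.  This is \<open>cointeraction_bas\<close>.

  \<^item> Multiplicativity.  If \<open>G\<close> has no edge between \<open>I\<close> and \<open>J\<close>, then the connected classes of an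
  admissible relation lie inside one of the parts.  So \<open>I\<close> is always saturated, and the same bijection
  gives \<open>delta_bas_plus\<close>.

  \<^item> Coassociativity of \<open>delta\<close>.  Both sides are sums over pairs \<open>r \<subseteq> t\<close> of admissible relations on \<open>G\<close>:
  a relation on \<open>G/r\<close> is the quotient \<open>t/r\<close> of a coarser relation, \<open>(G/r)/(t/r)\<close> is \<open>G/t\<close>, and
  \<open>(G/r)|(t/r)\<close> is \<open>(G|t)/r\<close>.  Admissibility is compatible with this, because a union of connected
  classes is connected exactly when its image in \<open>G/r\<close> is (\<open>connected_Union_classes\<close>).

  \<^item> The counit of \<open>delta\<close> is the indicator of edgeless graphs: \<open>G/r\<close> has no edges only when the
  classes of \<open>r\<close> are the connected components, and \<open>G|r\<close> has no edges only when \<open>r\<close> is equality.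

  \<^item> The antipode of \<open>Delta\<close> is the alternating sum of the convolution powers of the projection onto the
  augmentation ideal, a finite sum on each graph since the power \<open>k\<close> vanishes on graphs with fewer
  than \<open>k\<close> vertices.  The cointeraction says that convolution preserves comodule endomorphisms
  (\<open>comodule_hom_convolution\<close>), so every power is a comodule morphism, and hence so is the antipode.
\<close>

section \<open>Free vector spaces and their linear maps\<close>

lemma lookup_scale [simp]: "Poly_Mapping.lookup (scale c x) a = c * Poly_Mapping.lookup x a"
  unfolding scale_def by (simp add: Poly_Mapping.map.rep_eq when_def)

lemma scale_right_distrib: "scale c (x + y) = scale c x + scale c y"
  by (rule poly_mapping_eqI) (simp add: lookup_add algebra_simps)

lemma scale_left_distrib: "scale (c + d) x = scale c x + scale d x"
  by (rule poly_mapping_eqI) (simp add: lookup_add algebra_simps)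

lemma scale_scale: "scale c (scale d x) = scale (c * d) x"
  by (rule poly_mapping_eqI) simp

lemma scale_zero [simp]: "scale 0 x = 0" "scale c 0 = 0"
  by (rule poly_mapping_eqI, simp)+

lemma vector_space_scale: "vector_space scale"
  by unfold_locales (simp_all add: scale_right_distrib scale_left_distrib scale_scale scale_1)

lemma vector_space_rat: "vector_space ((*) :: rat \<Rightarrow> rat \<Rightarrow> rat)"
  by unfold_locales (simp_all add: algebra_simps)

lemma linear_mapI:
  assumes "\<And>x y. f (x + y) = f x + f y" "\<And>c x. f (scale c x) = scale c (f x)"
  shows "linear_map f"
  using assms
  by (simp add: vector_space_scale Vector_Spaces.linear_def module_hom_def module_hom_axioms_def module_iff_vector_space)

lemma linear_formI:
  assumes "\<And>x y. f (x + y) = f x + f y" "\<And>c x. f (scale c x) = c * f x"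
  shows "linear_form f"
  using assms
  by (simp add: vector_space_scale vector_space_rat Vector_Spaces.linear_def module_hom_def module_hom_axioms_def module_iff_vector_space)

lemma linear_map_add: "linear_map f \<Longrightarrow> f (x + y) = f x + f y"
  and linear_map_scale: "linear_map f \<Longrightarrow> f (scale c x) = scale c (f x)"
  and linear_form_add: "linear_form e \<Longrightarrow> e (x + y) = e x + e y"
  and linear_form_scale: "linear_form e \<Longrightarrow> e (scale c x) = c * e x"
  by (simp_all add: Vector_Spaces.linear_def module_hom_def module_hom_axioms_def)

lemma linear_map_zero: "linear_map f \<Longrightarrow> f 0 = 0"
  using linear_map_scale[of f 0 0] by simp

lemma linear_map_sum: "linear_map f \<Longrightarrow> f (sum g A) = (\<Sum>a\<in>A. f (g a))"
  by (induction A rule: infinite_finite_induct) (simp_all add: linear_map_zero linear_map_add)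

lemma free_expansion: "x = (\<Sum>a\<in>Poly_Mapping.keys x. scale (Poly_Mapping.lookup x a) (bas a))"
proof (rule poly_mapping_eqI)
  fix b
  have "(\<Sum>a\<in>Poly_Mapping.keys x. Poly_Mapping.lookup x a * (1 when a = b)) =
      (\<Sum>a\<in>Poly_Mapping.keys x. if a = b then Poly_Mapping.lookup x b else 0)"
    by (intro sum.cong) (auto simp: when_def)
  also have "\<dots> = Poly_Mapping.lookup x b"
    by (simp add: in_keys_iff)
  finally show "Poly_Mapping.lookup x b = Poly_Mapping.lookup
      (\<Sum>a\<in>Poly_Mapping.keys x. scale (Poly_Mapping.lookup x a) (bas a)) b"
    by (simp add: lookup_sum bas_def lookup_single)
qed

lemma linear_map_expansion:
  assumes "linear_map f"
  shows "f x = lin_ext (\<lambda>a. f (bas a)) x"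
proof -
  have "f x = f (\<Sum>a\<in>Poly_Mapping.keys x. scale (Poly_Mapping.lookup x a) (bas a))"
    by (rule arg_cong[where f = f, OF free_expansion])
  then show ?thesis
    by (simp only: linear_map_sum[OF assms] linear_map_scale[OF assms] lin_ext_def)
qed

text \<open>Uniqueness in the universal property of a basis. It reduces the identities between linear
  maps below to isoclasses.\<close>

lemma linear_map_eqI:
  assumes "linear_map f" "linear_map g" "\<And>a. f (bas a) = g (bas a)"
  shows "f x = g x"
  unfolding linear_map_expansion[OF assms(1), of x] linear_map_expansion[OF assms(2), of x]
  by (simp add: assms(3))

text \<open>Summing over a common finite superset of the supports makes the sums defining
  \<open>lin_ext\<close> comparable for different arguments.\<close>

lemma lin_ext_superset:
  assumes "finite A" "Poly_Mapping.keys x \<subseteq> A"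
  shows "lin_ext f x = (\<Sum>a\<in>A. scale (Poly_Mapping.lookup x a) (f a))"
  unfolding lin_ext_def
  by (rule sum.mono_neutral_left) (use assms in \<open>auto simp: in_keys_iff\<close>)

lemma linear_map_lin_ext: "linear_map (lin_ext f)"
proof (rule linear_mapI)
  fix x y :: "'a free" and c
  let ?A = "Poly_Mapping.keys x \<union> Poly_Mapping.keys y"
  show "lin_ext f (x + y) = lin_ext f x + lin_ext f y"
    using keys_add[of x y]
    by (subst (1 2 3) lin_ext_superset[of ?A])
      (auto simp: lookup_add scale_left_distrib sum.distrib)
  have "Poly_Mapping.keys (scale c x) \<subseteq> Poly_Mapping.keys x"
    by (auto simp: in_keys_iff)
  then show "lin_ext f (scale c x) = scale c (lin_ext f x)"
    by (subst (1 2) lin_ext_superset[of "Poly_Mapping.keys x"])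
      (simp_all add: poly_mapping_eq_iff fun_eq_iff lookup_sum sum_distrib_left mult.assoc)
qed

lemma linear_map_id: "linear_map id" "linear_map (\<lambda>x. x)"
  by (rule linear_mapI; simp)+

lemma linear_map_comp: "linear_map g \<Longrightarrow> linear_map f \<Longrightarrow> linear_map (\<lambda>x. g (f x))"
  by (rule linear_mapI) (simp_all add: linear_map_add linear_map_scale)

lemma linear_map_sum_fun:
  assumes "\<And>k. k \<in> A \<Longrightarrow> linear_map (f k)"
  shows "linear_map (\<lambda>x. \<Sum>k\<in>A. f k x)"
  by (rule linear_mapI)
    (simp_all add: linear_map_add linear_map_scale assms sum.distrib
      poly_mapping_eq_iff fun_eq_iff lookup_sum sum_distrib_left)

lemma linear_map_plus:
  "linear_map f \<Longrightarrow> linear_map g \<Longrightarrow> linear_map (\<lambda>x. f x + g x)"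
  by (rule linear_mapI) (simp_all add: linear_map_add linear_map_scale scale_right_distrib)

lemma linear_map_diff:
  "linear_map f \<Longrightarrow> linear_map g \<Longrightarrow> linear_map (\<lambda>x. f x - g x)"
  by (rule linear_mapI)
    (simp_all add: linear_map_add linear_map_scale poly_mapping_eq_iff fun_eq_iff
      lookup_minus algebra_simps)

lemma linear_map_scale_fun: "linear_map f \<Longrightarrow> linear_map (\<lambda>x. scale c (f x))"
  by (rule linear_mapI)
    (simp_all add: linear_map_add linear_map_scale scale_right_distrib scale_scale mult.commute)

lemma linear_map_form: "linear_form e \<Longrightarrow> linear_map (\<lambda>x. scale (e x) y)"
  by (rule linear_mapI) (simp_all add: linear_form_add linear_form_scale scale_left_distrib scale_scale)

lemma scale_single: "scale c (Poly_Mapping.single a d) = Poly_Mapping.single a (c * d)"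
  by (rule poly_mapping_eqI) (simp add: lookup_single when_def)

lemma scale_bas: "scale c (bas a) = Poly_Mapping.single a c"
  by (simp add: bas_def scale_single)

lemma scale_mult_left: "scale c x * y = scale c (x * y)"
  and scale_mult_right: "x * scale c y = scale c (x * y)"
  for x y :: "'a::comm_monoid_add free"
proof -
  \<comment> \<open>Scaling is multiplication by a constant, so ring associativity and commutativity give both laws.\<close>
  have *: "scale c z = Poly_Mapping.single 0 c * z" for z :: "'a free"
  proof -
    have "scale c z = (\<Sum>a\<in>Poly_Mapping.keys z. Poly_Mapping.single a (c * Poly_Mapping.lookup z a))"
      by (subst (1) free_expansion[of z])
        (simp add: linear_map_sum[OF linear_map_scale_fun[OF linear_map_id(2)]] scale_bas scale_single)
    also have "\<dots> = Poly_Mapping.single 0 c *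
        (\<Sum>a\<in>Poly_Mapping.keys z. Poly_Mapping.single a (Poly_Mapping.lookup z a))"
      by (simp add: sum_distrib_left mult_single)
    also have "\<dots> = Poly_Mapping.single 0 c * z"
      using free_expansion[of z] by (simp add: scale_bas)
    finally show ?thesis .
  qed
  show "scale c x * y = scale c (x * y)" "x * scale c y = scale c (x * y)"
    by (simp_all add: * mult.assoc mult.left_commute)
qed

lemma bas_mult: "bas a * bas b = bas (a + b)" for a :: "'a::comm_monoid_add"
  by (simp add: bas_def mult_single)

lemma bas_zero: "bas 0 = 1"
  by (simp add: bas_def)

lemma linear_map_mult_left: "linear_map f \<Longrightarrow> linear_map (\<lambda>x. f x * y)"
  and linear_map_mult_right: "linear_map f \<Longrightarrow> linear_map (\<lambda>x. y * f x)"
  for y :: "'a::comm_monoid_add free"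
  by (rule linear_mapI;
      simp add: linear_map_add linear_map_scale algebra_simps scale_mult_left scale_mult_right)+

lemma tensor_lin_ext: "x \<otimes> y = lin_ext (\<lambda>a. lin_ext (\<lambda>b. bas (a, b)) y) x"
  unfolding tensor_def lin_ext_def
  by (simp add: linear_map_sum[OF linear_map_scale_fun[OF linear_map_id(2)]] scale_scale)

lemma tensor_bas: "bas a \<otimes> bas b = bas (a, b)"
  by (simp add: tensor_lin_ext lin_ext_bas)

lemma linear_map_tensor_left: "linear_map f \<Longrightarrow> linear_map (\<lambda>x. f x \<otimes> y)"
  unfolding tensor_lin_ext by (rule linear_map_comp[OF linear_map_lin_ext])

lemma linear_map_tensor_right:
  assumes "linear_map f"
  shows "linear_map (\<lambda>y. x \<otimes> f y)"
  unfolding tensor_lin_ext lin_ext_def[of _ x]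
  by (intro linear_map_sum_fun linear_map_scale_fun linear_map_comp[OF linear_map_lin_ext assms])

lemma linear_map_tmap: "linear_map (tmap f g)"
  and linear_map_form_id: "linear_map (form_id e)"
  and linear_map_id_form: "linear_map (id_form e)"
  and linear_map_assoc: "linear_map assoc"
  and linear_map_mult: "linear_map mult"
  and linear_map_m_1_3_24: "linear_map m_1_3_24"
  by (simp_all add: tmap_def form_id_def id_form_def assoc_def mult_def m_1_3_24_def linear_map_lin_ext)

text \<open>The fixed linear maps enter in composed form \<open>\<lambda>x. h (f x)\<close>, so that
  linearity of a nested expression is found by peeling off one map at a time.\<close>

lemmas linear_map_intros =
  linear_map_id linear_map_lin_ext linear_map_sum_fun linear_map_plus linear_map_diff linear_map_scale_fun
  linear_map_mult_left linear_map_mult_right linear_map_tensor_left linear_map_tensor_right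
  linear_map_tmap[THEN linear_map_comp] linear_map_form_id[THEN linear_map_comp]
  linear_map_id_form[THEN linear_map_comp] linear_map_assoc[THEN linear_map_comp]
  linear_map_mult[THEN linear_map_comp] linear_map_m_1_3_24[THEN linear_map_comp]

lemma bilinear_eqI:
  assumes "\<And>y. linear_map (\<lambda>x. f x y)" "\<And>x. linear_map (f x)"
    "\<And>y. linear_map (\<lambda>x. g x y)" "\<And>x. linear_map (g x)"
    "\<And>a b. f (bas a) (bas b) = g (bas a) (bas b)"
  shows "f x y = g x y"
proof -
  have "f (bas a) y = g (bas a) y" for a
    by (rule linear_map_eqI[OF assms(2,4,5)])
  then show ?thesis
    by (rule linear_map_eqI[OF assms(1,3)])
qed

lemma tmap_tensor:
  assumes "linear_map f" "linear_map g"
  shows "tmap f g (x \<otimes> y) = f x \<otimes> g y"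
  by (rule bilinear_eqI[of "\<lambda>x y. tmap f g (x \<otimes> y)" "\<lambda>x y. f x \<otimes> g y"])
    (intro linear_map_intros assms | simp add: tensor_bas tmap_def lin_ext_bas)+

lemma tmap_bas: "tmap f g (bas (a, b)) = f (bas a) \<otimes> g (bas b)"
  by (simp add: tmap_def lin_ext_bas)

lemma mult_bas: "mult (bas (a, b)) = bas a * bas b"
  by (simp add: mult_def lin_ext_bas)

lemma mult_tensor: "mult (x \<otimes> y) = x * y"
  by (rule bilinear_eqI[of "\<lambda>x y. mult (x \<otimes> y)" "\<lambda>x y. x * y"])
    (intro linear_map_intros | simp add: tensor_bas mult_bas)+

lemma form_id_bas: "form_id e (bas (a, b)) = scale (e (bas a)) (bas b)"
  by (simp add: form_id_def lin_ext_bas)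

lemma id_form_bas: "id_form e (bas (a, b)) = scale (e (bas b)) (bas a)"
  by (simp add: id_form_def lin_ext_bas)

lemma assoc_bas: "assoc (bas ((a, b), c)) = bas (a, b, c)"
  by (simp add: assoc_def lin_ext_bas tensor_bas)

lemma m_1_3_24_bas: "m_1_3_24 (bas ((a, b), (c, d))) = bas ((a, c), b + d)"
  by (simp add: m_1_3_24_def lin_ext_bas tensor_bas bas_mult)

lemma tmap_comp:
  fixes x :: "('a \<times> 'b) free"
  assumes "linear_map f'" "linear_map g'"
  shows "tmap f' g' (tmap f g x) = tmap (\<lambda>x. f' (f x)) (\<lambda>x. g' (g x)) x"
proof (rule linear_map_eqI[where x = x])
  fix a :: "'a \<times> 'b"
  show "tmap f' g' (tmap f g (bas a)) = tmap (\<lambda>x. f' (f x)) (\<lambda>x. g' (g x)) (bas a)"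
    by (cases a) (simp add: tmap_bas tmap_tensor assms)
qed (intro linear_map_intros)+

lemma tmap_ident: "tmap id id x = x"
proof (rule linear_map_eqI)
  fix a :: "'a \<times> 'b"
  show "tmap id id (bas a) = bas a"
    by (cases a) (simp add: tmap_bas tensor_bas)
qed (simp_all add: linear_map_id linear_map_tmap)

lemma tensor_mult: "(x \<otimes> y) * (z \<otimes> w) = (x * z) \<otimes> (y * w)"
  for x z :: "'a::comm_monoid_add free" and y w :: "'b::comm_monoid_add free"
proof -
  have *: "bas (a, b) * (z \<otimes> w) = (bas a * z) \<otimes> (bas b * w)" for a :: 'a and b :: 'b
    by (rule bilinear_eqI[of "\<lambda>z w. bas (a, b) * (z \<otimes> w)" "\<lambda>z w. (bas a * z) \<otimes> (bas b * w)"])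
      (intro linear_map_intros | simp add: tensor_bas bas_mult)+
  show ?thesis
    by (rule bilinear_eqI[of "\<lambda>x y. (x \<otimes> y) * (z \<otimes> w)" "\<lambda>x y. (x * z) \<otimes> (y * w)"])
      (intro linear_map_intros | simp add: tensor_bas *)+
qed

text \<open>The linear extension of scalar values on the basis, in the shape in which \<open>eps\<close>
  is defined. Composing it with the embedding \<open>scale _ (bas ())\<close> of the ground
  field into \<open>unit free\<close> turns questions about linear forms into questions about
  linear maps.\<close>

definition form_ext :: "('a \<Rightarrow> rat) \<Rightarrow> 'a free \<Rightarrow> rat" where
  "form_ext \<phi> x = (\<Sum>a\<in>Poly_Mapping.keys x. Poly_Mapping.lookup x a * \<phi> a)"

lemma form_ext_lin_ext: "form_ext \<phi> x = Poly_Mapping.lookup (lin_ext (\<lambda>a. scale (\<phi> a) (bas ())) x) ()"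
  by (simp add: form_ext_def lin_ext_def lookup_sum bas_def)

lemma linear_form_form_ext: "linear_form (form_ext \<phi>)"
  by (rule linear_formI)
    (simp_all add: form_ext_lin_ext linear_map_add linear_map_scale linear_map_lin_ext lookup_add)

lemma form_ext_bas: "form_ext \<phi> (bas a) = \<phi> a"
  by (simp add: form_ext_lin_ext lin_ext_bas) (simp add: bas_def)

lemma linear_form_mult:
  fixes x y :: "'a::comm_monoid_add free"
  assumes "linear_form e" "\<And>a b. e (bas (a + b)) = e (bas a) * e (bas b)"
  shows "e (x * y) = e x * e y"
proof -
  have inj: "c = d" if "scale c (bas ()) = scale d (bas ())" for c d
    using arg_cong[OF that, of "\<lambda>x. Poly_Mapping.lookup x ()"] by (simp add: bas_def)
  have 1: "linear_map (\<lambda>x. scale (e x) z)" for z :: "unit free"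
    by (rule linear_map_form[OF assms(1)])
  have "scale (e (x * y)) (bas ()) = scale (e x) (scale (e y) (bas ()))"
  proof (rule bilinear_eqI[of "\<lambda>x y. scale (e (x * y)) (bas ())" "\<lambda>x y. scale (e x) (scale (e y) (bas ()))"])
    show "linear_map (\<lambda>x. scale (e (x * y)) (bas ()))" for y
      by (rule linear_map_comp[OF 1 linear_map_mult_left[OF linear_map_id(2)]])
    show "linear_map (\<lambda>y. scale (e (x * y)) (bas ()))" for x
      by (rule linear_map_comp[OF 1 linear_map_mult_right[OF linear_map_id(2)]])
    show "linear_map (\<lambda>x. scale (e x) (scale (e y) (bas ())))" for y
      by (rule 1)
    show "linear_map (\<lambda>y. scale (e x) (scale (e y) (bas ())))" for x
      by (rule linear_map_scale_fun[OF 1])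
  qed (simp add: bas_mult assms(2) scale_scale)
  then show ?thesis by (simp add: scale_scale inj)
qed

section \<open>Graphs: induced subgraphs and separations\<close>

lemma verts_simps [simp]:
  "verts (induced G I) = I" "verts (cut G r) = verts G" "verts (contract G r) = verts G // r"
  by (simp_all add: induced_def cut_def contract_def)

lemma isoclass_eqI: "iso_by f G H \<Longrightarrow> is_graph G \<Longrightarrow> isoclass G = isoclass H"
  using iso_by_is_graph[of f G H] by (auto simp: isoclass_eq_iff isomorphic_def)

lemma induced_induced: "K \<subseteq> I \<Longrightarrow> induced (induced G I) K = induced G K"
  by (auto simp: induced_def)

lemma induced_verts: "is_graph G \<Longrightarrow> induced G (verts G) = G"
  by (rule prod_eqI) (auto simp: induced_def is_graph_def)

lemma edge_ends: "is_graph G \<Longrightarrow> {x, y} \<in> edges G \<Longrightarrow> x \<in> verts G \<and> y \<in> verts G \<and> x \<noteq> y"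
  by (auto simp: is_graph_def)

lemma edge_pair: "is_graph G \<Longrightarrow> e \<in> edges G \<Longrightarrow> \<exists>x y. e = {x, y}"
  unfolding is_graph_def card_2_iff by blast

lemma contract_edge_iff:
  "{c, d} \<in> edges (contract G r) \<longleftrightarrow> c \<in> verts G // r \<and> d \<in> verts G // r \<and> c \<noteq> d \<and>
      (\<exists>x\<in>c. \<exists>y\<in>d. {x, y} \<in> edges G)"
proof -
  have "(\<exists>x\<in>c. \<exists>y\<in>d. {x, y} \<in> edges G) \<longleftrightarrow> (\<exists>x\<in>d. \<exists>y\<in>c. {x, y} \<in> edges G)" for c d
    by (metis insert_commute)
  then show ?thesis
    unfolding contract_def by (simp add: doubleton_eq_iff) blast
qed

lemma cut_edge_iff:
  "{x, y} \<in> edges (cut G t) \<longleftrightarrow> {x, y} \<in> edges G \<and> ((x, y) \<in> t \<or> (y, x) \<in> t)"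
proof -
  have "{y, x} \<in> edges G \<longleftrightarrow> {x, y} \<in> edges G" by (simp add: insert_commute)
  then show ?thesis
    unfolding cut_def snd_conv mem_Collect_eq doubleton_eq_iff by blast
qed

lemma cut_cut: "r \<subseteq> t \<Longrightarrow> cut (cut G t) r = cut G r"
proof (rule prod_eqI)
  assume "r \<subseteq> t"
  then have "{x, y} \<in> edges (cut G t) \<and> (x, y) \<in> r \<longleftrightarrow> {x, y} \<in> edges G \<and> (x, y) \<in> r" for x y
    unfolding cut_edge_iff by blast
  then show "edges (cut (cut G t) r) = edges (cut G r)"
    by (simp add: cut_def[of _ r])
qed simp

lemma finite_admissible: "is_graph G \<Longrightarrow> finite (admissible G)"
  by (rule finite_subset[of _ "Pow (verts G \<times> verts G)"])
    (auto simp: admissible_def is_graph_def elim: equivE)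

lemma admissible_equiv: "r \<in> admissible G \<Longrightarrow> equiv (verts G) r"
  by (simp add: admissible_def)

lemma class_eq_iff:
  assumes "equiv V r" "x \<in> V" "y \<in> V"
  shows "r `` {x} = r `` {y} \<longleftrightarrow> (x, y) \<in> r"
  using eq_equiv_class_iff[OF assms] .

lemma class_of_member: "equiv V r \<Longrightarrow> c \<in> V // r \<Longrightarrow> x \<in> c \<Longrightarrow> r `` {x} = c"
  by (metis Image_singleton_iff equiv_class_eq quotientE)

lemma isoclass_eq_0_iff:
  assumes "is_graph G"
  shows "isoclass G = 0 \<longleftrightarrow> verts G = {}"
proof -
  have "is_graph (({}, {}) :: nat graph)" by (simp add: is_graph_def)
  then have "isoclass G = 0 \<longleftrightarrow> isomorphic G (({}, {}) :: nat graph)"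
    unfolding zero_isograph_def by (rule isoclass_eq_iff[OF assms])
  also have "\<dots> \<longleftrightarrow> verts G = {}"
  proof
    assume "verts G = {}"
    moreover from this have "edges G = {}"
      using assms by (auto simp: is_graph_def)
    ultimately show "isomorphic G (({}, {}) :: nat graph)"
      by (auto simp: isomorphic_def iso_by_def bij_betw_def)
  qed (auto simp: isomorphic_def iso_by_def bij_betw_def)
  finally show ?thesis .
qed

text \<open>\<open>G\<close> is the disjoint union of its induced subgraphs on \<open>I\<close> and
  \<open>J\<close>, expressed without changing the vertex type.\<close>

definition separated :: "'a graph \<Rightarrow> 'a set \<Rightarrow> 'a set \<Rightarrow> bool" where
  "separated G I J \<longleftrightarrow> I \<union> J = verts G \<and> I \<inter> J = {} \<and> (\<forall>e\<in>edges G. e \<subseteq> I \<or> e \<subseteq> J)"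

lemma isoclass_separated:
  assumes "is_graph G" "separated G I J"
  shows "isoclass G = isoclass (induced G I) + isoclass (induced G J)"
proof -
  have IJ: "I \<union> J = verts G" "I \<inter> J = {}" and E: "\<And>e. e \<in> edges G \<Longrightarrow> e \<subseteq> I \<or> e \<subseteq> J"
    using assms(2) by (auto simp: separated_def)
  have g: "is_graph (induced G I)" "is_graph (induced G J)"
    using is_graph_induced[OF assms(1)] IJ by blast+
  have "bij_betw (case_sum id id) (I <+> J) (verts G)"
    using IJ by (auto simp: bij_betw_def inj_on_def Plus_def image_Un image_image)
  moreover have "edges G = {e \<in> edges G. e \<subseteq> I} \<union> {e \<in> edges G. e \<subseteq> J}"
    using E by blast
  ultimately have "iso_by (case_sum id id) (disj_union (induced G I) (induced G J)) G"
    by (simp add: iso_by_def disj_union_def induced_def image_Un image_image)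
  then show ?thesis
    by (simp add: isoclass_eqI[OF _ is_graph_disj_union[OF g]] isoclass_plus[OF g])
qed

lemma separated_induced:
  assumes "separated G I J" "K \<subseteq> I" "L \<subseteq> J"
  shows "separated (induced G (K \<union> L)) K L"
proof -
  have IJ: "I \<inter> J = {}" and E: "\<And>e. e \<in> edges G \<Longrightarrow> e \<subseteq> I \<or> e \<subseteq> J"
    using assms(1) by (auto simp: separated_def)
  have "e \<subseteq> K \<or> e \<subseteq> L" if "e \<in> edges G" "e \<subseteq> K \<union> L" for e
    using E[OF that(1)]
  proof
    assume "e \<subseteq> I"
    then have "e \<subseteq> K" using that(2) assms(3) IJ by blast
    then show ?thesis ..
  next
    assume "e \<subseteq> J"
    then have "e \<subseteq> L" using that(2) assms(2) IJ by blast
    then show ?thesis ..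
  qed
  moreover have "K \<inter> L = {}" using assms(2,3) IJ by blast
  ultimately show ?thesis
    by (simp add: separated_def induced_def)
qed

text \<open>Every product of two isoclasses is realized inside one graph by a separation.
  Multiplicativity can then be proved with subsets and relations of that graph, in place of
  maps between sum types.\<close>

lemma isoclass_plus_cases:
  obtains G :: "(nat + nat) graph" and I J where "is_graph G" "separated G I J"
    "A = isoclass (induced G I)" "B = isoclass (induced G J)"
proof -
  obtain H :: "nat graph" where H: "is_graph H" "A = isoclass H" by (rule isoclass_cases)
  obtain K :: "nat graph" where K: "is_graph K" "B = isoclass K" by (rule isoclass_cases)
  let ?G = "disj_union H K" and ?I = "Inl ` verts H :: (nat + nat) set" and ?J = "Inr ` verts K :: (nat + nat) set"
  have ed: "e \<noteq> {}" "e \<subseteq> verts H" if "e \<in> edges H" for e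
    using that H(1) by (auto simp: is_graph_def)
  have ed': "e \<noteq> {}" "e \<subseteq> verts K" if "e \<in> edges K" for e
    using that K(1) by (auto simp: is_graph_def)
  have "{e \<in> edges ?G. e \<subseteq> ?I} = (\<lambda>e. Inl ` e) ` edges H"
    using ed ed' by (fastforce simp: disj_union_def)
  then have "iso_by Inl H (induced ?G ?I)"
    by (simp add: iso_by_def induced_def bij_betw_def)
  moreover have "{e \<in> edges ?G. e \<subseteq> ?J} = (\<lambda>e. Inr ` e) ` edges K"
    using ed ed' by (fastforce simp: disj_union_def)
  then have "iso_by Inr K (induced ?G ?J)"
    by (simp add: iso_by_def induced_def bij_betw_def)
  moreover have "separated ?G ?I ?J"
    using ed ed' by (fastforce simp: separated_def disj_union_def)
  ultimately show ?thesis
    using isoclass_eqI[OF _ H(1)] isoclass_eqI[OF _ K(1)]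
    by (intro that[OF is_graph_disj_union[OF H(1) K(1)]]) (simp_all add: H(2) K(2))
qed

section \<open>The coproduct of vertex subsets\<close>

lemma complement_unique: "I \<union> J = V \<Longrightarrow> I \<inter> J = {} \<Longrightarrow> V - I = J"
  by blast

text \<open>A splitting is determined by its first part, which leaves a single index to sum over.\<close>

lemma Delta_isoclass_Pow:
  assumes "is_graph G"
  shows "Delta (bas (isoclass G)) = (\<Sum>I\<in>Pow (verts G).
    bas (isoclass (induced G I), isoclass (induced G (verts G - I))))"
  unfolding Delta_isoclass[OF assms] Delta_sum_def
  by (rule sum.reindex_bij_witness[where i = "\<lambda>I. (I, verts G - I)" and j = fst])
    (auto simp: tensor_bas complement_unique)

lemma sum_Pow_Un:
  assumes "I \<inter> J = {}"
  shows "(\<Sum>K\<in>Pow (I \<union> J). f K) = (\<Sum>K\<in>Pow I. \<Sum>L\<in>Pow J. f (K \<union> L))"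
  unfolding sum.cartesian_product
  by (rule sum.reindex_bij_witness[where i = "\<lambda>(K, L). K \<union> L" and j = "\<lambda>K. (K \<inter> I, K \<inter> J)"])
    (use assms in \<open>auto intro!: arg_cong[where f = f]\<close>)

text \<open>A subset of a separated graph is a pair of subsets of the two parts, and it induces a
  separated subgraph.\<close>

lemma Delta_bas_plus: "Delta (bas (A + B)) = Delta (bas A) * Delta (bas B)"
proof -
  obtain G :: "(nat + nat) graph" and I J where G: "is_graph G" and sep: "separated G I J"
    and A: "A = isoclass (induced G I)" and B: "B = isoclass (induced G J)"
    by (rule isoclass_plus_cases)
  have V: "verts G = I \<union> J" "I \<inter> J = {}" using sep by (auto simp: separated_def)
  have iso: "isoclass (induced G (K \<union> L)) = isoclass (induced G K) + isoclass (induced G L)"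
    if "K \<subseteq> I" "L \<subseteq> J" for K L
    using isoclass_separated[OF is_graph_induced[OF G] separated_induced[OF sep that]] that V
    by (simp add: induced_induced) blast
  have "Delta (bas (A + B)) = (\<Sum>K\<in>Pow I. \<Sum>L\<in>Pow J.
      bas (isoclass (induced G (K \<union> L)), isoclass (induced G (verts G - (K \<union> L)))))"
    by (simp add: A B isoclass_separated[OF G sep, symmetric] Delta_isoclass_Pow[OF G] V sum_Pow_Un)
  also have "\<dots> = (\<Sum>K\<in>Pow I. \<Sum>L\<in>Pow J.
      bas (isoclass (induced G K), isoclass (induced G (I - K))) *
      bas (isoclass (induced G L), isoclass (induced G (J - L))))"
  proof (intro sum.cong refl)
    fix K L assume KL: "K \<in> Pow I" "L \<in> Pow J"
    then have "verts G - (K \<union> L) = (I - K) \<union> (J - L)" using V by blast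
    then show "bas (isoclass (induced G (K \<union> L)), isoclass (induced G (verts G - (K \<union> L)))) =
      bas (isoclass (induced G K), isoclass (induced G (I - K))) *
      bas (isoclass (induced G L), isoclass (induced G (J - L)))"
      using KL iso[of K L] iso[of "I - K" "J - L"] by (simp add: bas_mult)
  qed
  also have "\<dots> = Delta (bas A) * Delta (bas B)"
    using V by (simp add: A B Delta_isoclass_Pow is_graph_induced[OF G] induced_induced sum_product)
  finally show ?thesis .
qed

text \<open>Both sides sum over ordered splittings into three parts. On the left these are given by
  \<open>K \<subseteq> I\<close>, with parts \<open>K\<close>, \<open>I - K\<close> and the
  complement of \<open>I\<close>; on the right the first part \<open>K\<close> is chosen
  before the second one.\<close>

lemma Delta_coassoc_bas:
  "assoc (tmap Delta id (Delta (bas C))) = tmap id Delta (Delta (bas C))"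
proof -
  obtain G :: "nat graph" where G: "is_graph G" and C: "C = isoclass G" by (rule isoclass_cases)
  let ?V = "verts G" and ?c = "\<lambda>I. isoclass (induced G I)"
  have fin: "finite ?V" using G by (simp add: is_graph_def)
  have D: "Delta (bas (?c I)) = (\<Sum>K\<in>Pow I. bas (?c K, ?c (I - K)))" if "I \<subseteq> ?V" for I
    using Delta_isoclass_Pow[OF is_graph_induced[OF G that]] by (simp add: induced_induced)
  have DC: "Delta (bas C) = (\<Sum>I\<in>Pow ?V. bas (?c I, ?c (?V - I)))"
    unfolding C by (rule Delta_isoclass_Pow[OF G])
  have "assoc (tmap Delta id (Delta (bas C))) =
      (\<Sum>I\<in>Pow ?V. \<Sum>K\<in>Pow I. bas (?c K, ?c (I - K), ?c (?V - I)))"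
    by (simp add: DC linear_map_sum linear_map_tmap linear_map_assoc tmap_bas D
        linear_map_sum[OF linear_map_tensor_left[OF linear_map_id(2)]] tensor_bas assoc_bas)
  also have "\<dots> = (\<Sum>(I, K)\<in>Sigma (Pow ?V) Pow. bas (?c K, ?c (I - K), ?c (?V - I)))"
    by (rule sum.Sigma) (auto intro: finite_subset[OF _ fin] simp: fin)
  also have "\<dots> = (\<Sum>(K, L)\<in>(SIGMA K:Pow ?V. Pow (?V - K)). bas (?c K, ?c L, ?c (?V - K - L)))"
  proof (rule sum.reindex_bij_witness[where i = "\<lambda>(K, L). (K \<union> L, K)" and j = "\<lambda>(I, K). (K, I - K)"])
    fix p assume "p \<in> Sigma (Pow ?V) Pow"
    then obtain I K where p: "p = (I, K)" "K \<subseteq> I" "I \<subseteq> ?V" by auto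
    then have "?V - K - (I - K) = ?V - I" "K \<union> (I - K) = I" by blast+
    then show "(case case p of (I, K) \<Rightarrow> (K, I - K) of (K, L) \<Rightarrow> bas (?c K, ?c L, ?c (?V - K - L))) =
        (case p of (I, K) \<Rightarrow> bas (?c K, ?c (I - K), ?c (?V - I)))"
      using p(1) by simp
  qed auto
  also have "\<dots> = (\<Sum>K\<in>Pow ?V. \<Sum>L\<in>Pow (?V - K). bas (?c K, ?c L, ?c (?V - K - L)))"
    by (rule sum.Sigma[symmetric]) (auto simp: fin)
  also have "\<dots> = tmap id Delta (Delta (bas C))"
    by (simp add: DC linear_map_sum linear_map_tmap tmap_bas D
        linear_map_sum[OF linear_map_tensor_right[OF linear_map_id(2)]] tensor_bas)
  finally show ?thesis .
qed

text \<open>The symmetry is complementation of the first part.\<close>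

lemma Delta_cocommutative_bas: "Delta (bas C) = lin_ext (\<lambda>(A, B). bas (B, A)) (Delta (bas C))"
proof -
  obtain G :: "nat graph" where G: "is_graph G" and C: "C = isoclass G" by (rule isoclass_cases)
  show ?thesis
    unfolding C Delta_isoclass_Pow[OF G] linear_map_sum[OF linear_map_lin_ext] lin_ext_bas prod.case
    by (rule sum.reindex_bij_witness[where i = "\<lambda>I. verts G - I" and j = "\<lambda>I. verts G - I"])
      (auto simp: double_diff)
qed

section \<open>Saturated vertex sets, multiplicativity and cointeraction\<close>

lemma delta_isoclass_admissible:
  assumes "is_graph G"
  shows "delta (bas (isoclass G)) =
    (\<Sum>r\<in>admissible G. bas (isoclass (contract G r), isoclass (cut G r)))"
  by (simp add: delta_isoclass[OF assms] delta_sum_def tensor_bas)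

text \<open>\<open>I\<close> is a union of classes, as far as the field of \<open>t\<close> is
  concerned. The definition does not mention the ground set, so that it applies to
  \<open>I\<close> and to its complement alike.\<close>

definition saturated :: "'a rel \<Rightarrow> 'a set \<Rightarrow> bool" where
  "saturated t I \<longleftrightarrow> (\<forall>(x, y)\<in>t. x \<in> I \<longleftrightarrow> y \<in> I)"

lemma saturated_image:
  assumes "saturated t I" "x \<in> I"
  shows "t `` {x} \<subseteq> I"
  using assms by (auto simp: saturated_def)

lemma Restr_equiv:
  assumes "equiv V t" "I \<subseteq> V"
  shows "equiv I (Restr t I)"
proof -
  have t: "refl_on V t" "sym t" "trans t" using assms(1) by (auto elim: equivE)
  show ?thesis
  proof (rule equivI)
    show "Restr t I \<subseteq> I \<times> I" by blast
    show "refl_on I (Restr t I)" using t(1) assms(2) by (auto simp: refl_on_def)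
    show "sym (Restr t I)" using t(2) by (auto simp: sym_def)
    show "trans (Restr t I)" using t(3) by (rule trans_Restr)
  qed
qed

lemma quotient_Restr:
  assumes "saturated t I"
  shows "I // Restr t I = I // t"
proof -
  have "Restr t I `` {x} = t `` {x}" if "x \<in> I" for x
    using saturated_image[OF assms that] that by blast
  then show ?thesis by (simp add: quotient_def)
qed

lemma saturated_Compl:
  assumes "saturated t I" "equiv V t"
  shows "saturated t (V - I)"
  using assms unfolding saturated_def by (blast elim: equivE)

lemma quotient_Diff:
  assumes "equiv V t" "I \<subseteq> V" "saturated t I"
  shows "(V - I) // t = V // t - I // t"
proof -
  have "t `` {x} \<noteq> t `` {y}" if "x \<in> I" "y \<in> V - I" for x y
    using saturated_image[OF assms(3) that(1)] equiv_class_self[OF assms(1)] that by blast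
  then show ?thesis
    using assms(2) unfolding quotient_def by blast
qed

lemma quotient_mono: "I \<subseteq> V \<Longrightarrow> I // t \<subseteq> V // t"
  by (auto simp: quotient_def)

lemma quotient_class_subset: "saturated t I \<Longrightarrow> c \<in> I // t \<Longrightarrow> c \<subseteq> I"
  using saturated_image by (fastforce simp: quotient_def)

lemma Collect_image2: "{e \<in> {f c d |c d. P c d}. R e} = {f c d |c d. P c d \<and> R (f c d)}"
  by blast

text \<open>A class of \<open>t\<close> meeting a saturated \<open>I\<close> lies inside
  \<open>I\<close>, so the restricted relation has literally the same classes as
  \<open>t\<close> there, and the two graphs are equal rather than isomorphic.\<close>

lemma induced_contract:
  assumes "I \<subseteq> verts G" "saturated t I"
  shows "induced (contract G t) (I // t) = contract (induced G I) (Restr t I)"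
proof (rule prod_eqI)
  note Q = quotient_mono[OF assms(1), of t] and S = quotient_class_subset[OF assms(2)]
  have "(c \<in> verts G // t \<and> d \<in> verts G // t \<and> c \<noteq> d \<and> (\<exists>x\<in>c. \<exists>y\<in>d. {x, y} \<in> edges G)) \<and>
        {c, d} \<subseteq> I // t \<longleftrightarrow>
      c \<in> I // t \<and> d \<in> I // t \<and> c \<noteq> d \<and> (\<exists>x\<in>c. \<exists>y\<in>d. {x, y} \<in> edges G \<and> {x, y} \<subseteq> I)" for c d
  proof (cases "c \<in> I // t \<and> d \<in> I // t")
    case True
    then have "c \<in> verts G // t" "d \<in> verts G // t" "\<forall>x\<in>c. x \<in> I" "\<forall>y\<in>d. y \<in> I"
      using subsetD[OF Q] subsetD[OF S[of c]] subsetD[OF S[of d]] by blast+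
    then show ?thesis using True by simp
  qed auto
  then show "edges (induced (contract G t) (I // t)) = edges (contract (induced G I) (Restr t I))"
    unfolding contract_def induced_def snd_conv fst_conv quotient_Restr[OF assms(2)]
      Collect_image2
    by (simp only: mem_Collect_eq)
qed (simp add: quotient_Restr[OF assms(2)])

lemma induced_cut: "induced (cut G t) I = cut (induced G I) (Restr t I)"
  by (rule prod_eqI) (auto simp: induced_def cut_def)

lemma separated_cut:
  assumes "I \<subseteq> verts G" "saturated t I" "is_graph G"
  shows "separated (cut G t) I (verts G - I)"
proof -
  have "{x, y} \<subseteq> I \<or> {x, y} \<subseteq> verts G - I" if "{x, y} \<in> edges G" "(x, y) \<in> t" for x y
    using edge_ends[OF assms(3) that(1)] assms(2) that(2) by (auto simp: saturated_def)
  then show ?thesis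
    using assms(1) by (auto simp: separated_def cut_def)
qed

lemma isoclass_cut_saturated:
  assumes "I \<subseteq> verts G" "saturated t I" "is_graph G"
  shows "isoclass (cut G t) = isoclass (cut (induced G I) (Restr t I)) +
    isoclass (cut (induced G (verts G - I)) (Restr t (verts G - I)))"
  using isoclass_separated[OF is_graph_cut[OF assms(3)] separated_cut[OF assms]]
  by (simp add: induced_cut)

lemma admissible_Restr:
  assumes "t \<in> admissible G" "I \<subseteq> verts G" "saturated t I"
  shows "Restr t I \<in> admissible (induced G I)"
proof -
  have t: "equiv (verts G) t" "\<And>c. c \<in> verts G // t \<Longrightarrow> connected_graph (induced G c)"
    using assms(1) by (auto simp: admissible_def)
  have "connected_graph (induced (induced G I) c)" if "c \<in> I // t" for c
    using t(2)[of c] that quotient_mono[OF assms(2), of t] quotient_class_subset[OF assms(3) that]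
    by (auto simp: induced_induced)
  then show ?thesis
    by (simp add: admissible_def Restr_equiv[OF t(1) assms(2)] quotient_Restr[OF assms(3)])
qed

text \<open>The inverse of restriction to two complementary saturated sets: admissible relations on both
  parts glue, because the classes of the union are those of the two relations.\<close>

lemma admissible_Un:
  assumes "r \<in> admissible (induced G I)" "s \<in> admissible (induced G J)"
    "I \<union> J = verts G" "I \<inter> J = {}"
  shows "r \<union> s \<in> admissible G" "saturated (r \<union> s) I" "Restr (r \<union> s) I = r" "Restr (r \<union> s) J = s"
proof -
  have r: "equiv I r" "\<And>c. c \<in> I // r \<Longrightarrow> connected_graph (induced (induced G I) c)"
    and s: "equiv J s" "\<And>c. c \<in> J // s \<Longrightarrow> connected_graph (induced (induced G J) c)"
    using assms(1,2) by (auto simp: admissible_def)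
  have rs: "r \<subseteq> I \<times> I" "s \<subseteq> J \<times> J" using r(1) s(1) by (auto elim: equivE)
  show R: "Restr (r \<union> s) I = r" "Restr (r \<union> s) J = s" using rs assms(4) by auto
  show sat: "saturated (r \<union> s) I"
    unfolding saturated_def using rs assms(4) by auto
  have sat': "saturated (r \<union> s) J"
    unfolding saturated_def using rs assms(4) by auto
  have e: "equiv (verts G) (r \<union> s)"
  proof (rule equivI)
    show "r \<union> s \<subseteq> verts G \<times> verts G" using rs assms(3) by blast
    show "refl_on (verts G) (r \<union> s)"
      using r(1) s(1) assms(3) by (auto simp: equiv_def refl_on_def)
    show "sym (r \<union> s)" using r(1) s(1) by (auto simp: equiv_def intro: sym_Un)
    show "trans (r \<union> s)"
    proof (rule transI)
      fix x y z assume "(x, y) \<in> r \<union> s" "(y, z) \<in> r \<union> s"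
      then have "(x, y) \<in> r \<and> (y, z) \<in> r \<or> (x, y) \<in> s \<and> (y, z) \<in> s"
        using rs assms(4) by blast
      then show "(x, z) \<in> r \<union> s"
        using r(1) s(1) by (meson UnCI equiv_def transD)
    qed
  qed
  have "verts G // (r \<union> s) = I // (r \<union> s) \<union> J // (r \<union> s)"
    using assms(3) by (auto simp: quotient_def)
  also have "\<dots> = I // r \<union> J // s"
    using quotient_Restr[OF sat] quotient_Restr[OF sat'] by (simp add: R)
  finally have Q: "verts G // (r \<union> s) = I // r \<union> J // s" .
  have "connected_graph (induced G c)" if "c \<in> I // r \<union> J // s" for c
    using that r(2)[of c] s(2)[of c] quotient_subset[OF r(1), of c] quotient_subset[OF s(1), of c]
    by (auto simp: induced_induced)
  then show "r \<union> s \<in> admissible G"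
    using e by (simp add: admissible_def Q)
qed

text \<open>Splitting a relation along a saturated set is the bijection behind both the multiplicativity
  of \<open>delta\<close> and the cointeraction.\<close>

lemma sum_saturated:
  assumes "I \<union> J = verts G" "I \<inter> J = {}"
  shows "(\<Sum>r\<in>admissible (induced G I). \<Sum>s\<in>admissible (induced G J). f r s) =
    (\<Sum>t\<in>{t \<in> admissible G. saturated t I}. f (Restr t I) (Restr t J))"
  unfolding sum.cartesian_product
proof (rule sum.reindex_bij_witness[where i = "\<lambda>t. (Restr t I, Restr t J)" and j = "\<lambda>(r, s). r \<union> s"])
  fix p assume "p \<in> admissible (induced G I) \<times> admissible (induced G J)"
  then obtain r s where p: "p = (r, s)" "r \<in> admissible (induced G I)" "s \<in> admissible (induced G J)"
    by auto
  note U = admissible_Un[OF p(2,3) assms]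
  show "(Restr (case p of (r, s) \<Rightarrow> r \<union> s) I, Restr (case p of (r, s) \<Rightarrow> r \<union> s) J) = p"
    "(case p of (r, s) \<Rightarrow> r \<union> s) \<in> {t \<in> admissible G. saturated t I}"
    "f (Restr (case p of (r, s) \<Rightarrow> r \<union> s) I) (Restr (case p of (r, s) \<Rightarrow> r \<union> s) J) =
        (case p of (r, s) \<Rightarrow> f r s)"
    using U by (simp_all add: p(1))
next
  fix t assume "t \<in> {t \<in> admissible G. saturated t I}"
  then have t: "t \<in> admissible G" "saturated t I" by auto
  have J: "verts G - I = J" using assms by blast
  have sJ: "saturated t J"
    using saturated_Compl[OF t(2) admissible_equiv[OF t(1)]] by (simp add: J)
  have "t \<subseteq> verts G \<times> verts G" using admissible_equiv[OF t(1)] by (rule equivE)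
  then show "(case (Restr t I, Restr t J) of (r, s) \<Rightarrow> r \<union> s) = t"
    using t(2) assms by (auto simp: saturated_def)
  show "(Restr t I, Restr t J) \<in> admissible (induced G I) \<times> admissible (induced G J)"
    using admissible_Restr[OF t(1) _ t(2)] admissible_Restr[OF t(1) _ sJ] assms by auto
qed

text \<open>A class of an admissible relation is connected, and a path cannot cross a separation.\<close>

lemma admissible_saturated:
  assumes "t \<in> admissible G" "separated G I J"
  shows "saturated t I"
proof -
  have IJ: "I \<union> J = verts G" "I \<inter> J = {}" and E: "\<And>e. e \<in> edges G \<Longrightarrow> e \<subseteq> I \<or> e \<subseteq> J"
    using assms(2) by (auto simp: separated_def)
  have t: "equiv (verts G) t" "\<And>c. c \<in> verts G // t \<Longrightarrow> connected_graph (induced G c)"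
    using assms(1) by (auto simp: admissible_def)
  have path: "u \<in> I \<longleftrightarrow> v \<in> I" if "(u, v) \<in> {(u, v). {u, v} \<in> edges (induced G c)}\<^sup>*" for u v c
    using that
  proof (induction rule: rtrancl_induct)
    case (step y z)
    then have "{y, z} \<subseteq> I \<or> {y, z} \<subseteq> J" using E by (auto simp: induced_def)
    then show ?case using step.IH IJ by auto
  qed simp
  have "x \<in> I \<longleftrightarrow> y \<in> I" if "(x, y) \<in> t" for x y
  proof -
    have "x \<in> verts G" using t(1) that by (auto elim: equivE)
    then have "x \<in> t `` {x}" "t `` {x} \<in> verts G // t"
      using equiv_class_self[OF t(1)] by (auto simp: quotientI)
    then show ?thesis
      using t(2) that path unfolding connected_graph_def by fastforce
  qed
  then show ?thesis by (auto simp: saturated_def)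
qed

lemma separated_contract:
  assumes "equiv (verts G) t" "separated G I J" "saturated t I"
  shows "separated (contract G t) (I // t) (J // t)"
proof -
  have IJ: "I \<union> J = verts G" "I \<inter> J = {}" and E: "\<And>e. e \<in> edges G \<Longrightarrow> e \<subseteq> I \<or> e \<subseteq> J"
    using assms(2) by (auto simp: separated_def)
  have J: "J = verts G - I" using IJ by blast
  have Q: "J // t = verts G // t - I // t" "I // t \<subseteq> verts G // t"
    using quotient_Diff[OF assms(1) _ assms(3)] quotient_mono[of I "verts G" t] IJ J by auto
  have sJ: "saturated t J"
    using saturated_Compl[OF assms(3,1)] J by simp
  have "{c, d} \<subseteq> I // t \<or> {c, d} \<subseteq> J // t"
    if "c \<in> verts G // t" "d \<in> verts G // t" "x \<in> c" "y \<in> d" "{x, y} \<in> edges G" for c d x y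
  proof -
    have "c = t `` {x}" "d = t `` {y}"
      using class_of_member[OF assms(1)] that by blast+
    then show ?thesis
      using E[OF that(5)] by (auto simp: quotientI)
  qed
  then have "\<forall>e\<in>edges (contract G t). e \<subseteq> I // t \<or> e \<subseteq> J // t"
    unfolding contract_def snd_conv by blast
  then show ?thesis
    using Q by (auto simp: separated_def)
qed

text \<open>Inside a separated graph every admissible relation splits, and both its contraction and its
  cut are again separated.\<close>

lemma delta_bas_plus: "delta (bas (A + B)) = delta (bas A) * delta (bas B)"
proof -
  obtain G :: "(nat + nat) graph" and I J where G: "is_graph G" and sep: "separated G I J"
    and A: "A = isoclass (induced G I)" and B: "B = isoclass (induced G J)"
    by (rule isoclass_plus_cases)
  have IJ: "I \<union> J = verts G" "I \<inter> J = {}" using sep by (auto simp: separated_def)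
  then have I: "I \<subseteq> verts G" "J \<subseteq> verts G" "verts G - I = J" by auto
  let ?f = "\<lambda>r s. bas (isoclass (contract (induced G I) r), isoclass (cut (induced G I) r)) *
      bas (isoclass (contract (induced G J) s), isoclass (cut (induced G J) s))"
  have "delta (bas (A + B)) = (\<Sum>t\<in>admissible G. bas (isoclass (contract G t), isoclass (cut G t)))"
    by (simp add: A B isoclass_separated[OF G sep, symmetric] delta_isoclass_admissible[OF G])
  also have "\<dots> = (\<Sum>t\<in>{t \<in> admissible G. saturated t I}. ?f (Restr t I) (Restr t J))"
  proof (rule sum.cong)
    show "admissible G = {t \<in> admissible G. saturated t I}"
      using admissible_saturated[OF _ sep] by auto
    fix t assume "t \<in> {t \<in> admissible G. saturated t I}"
    then have t: "t \<in> admissible G" "saturated t I" "equiv (verts G) t"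
      by (auto simp: admissible_def)
    have sJ: "saturated t J" using saturated_Compl[OF t(2,3)] I by simp
    have "isoclass (contract G t) =
        isoclass (contract (induced G I) (Restr t I)) + isoclass (contract (induced G J) (Restr t J))"
      using isoclass_separated[OF is_graph_contract[OF G t(3)] separated_contract[OF t(3) sep t(2)]]
      by (simp add: induced_contract I t(2) sJ)
    then show "bas (isoclass (contract G t), isoclass (cut G t)) = ?f (Restr t I) (Restr t J)"
      using isoclass_cut_saturated[OF I(1) t(2) G] by (simp add: bas_mult I(3))
  qed
  also have "\<dots> = (\<Sum>r\<in>admissible (induced G I). \<Sum>s\<in>admissible (induced G J). ?f r s)"
    by (rule sum_saturated[OF IJ, symmetric])
  also have "\<dots> = delta (bas A) * delta (bas B)"
    using I by (simp add: A B delta_isoclass_admissible is_graph_induced[OF G] sum_product)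
  finally show ?thesis .
qed

text \<open>Taking unions identifies sets of classes with saturated sets of vertices.\<close>

lemma sum_Pow_quotient:
  assumes "equiv V t"
  shows "(\<Sum>I\<in>{I \<in> Pow V. saturated t I}. f (I // t)) = (\<Sum>X\<in>Pow (V // t). f X)"
proof (rule sum.reindex_bij_witness[where i = Union and j = "\<lambda>I. I // t"])
  fix I assume "I \<in> {I \<in> Pow V. saturated t I}"
  then have I: "I \<subseteq> V" "saturated t I" by auto
  show "\<Union> (I // t) = I"
    using quotient_Restr[OF I(2)] Union_quotient[OF Restr_equiv[OF assms I(1)]] by simp
  show "I // t \<in> Pow (V // t)" using quotient_mono[OF I(1)] by blast
next
  fix X assume X: "X \<in> Pow (V // t)"
  have cls: "t `` {x} = c" if "c \<in> X" "x \<in> c" for c x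
    using class_of_member[OF assms] that X by blast
  have ne: "c \<noteq> {}" if "c \<in> X" for c
    using that X in_quotient_imp_non_empty[OF assms] by blast
  have "\<Union> X // t = (\<Union>c\<in>X. \<Union>x\<in>c. {t `` {x}})" by (auto simp: quotient_def)
  also have "\<dots> = (\<Union>c\<in>X. \<Union>x\<in>c. {c})" using cls by simp
  also have "\<dots> = X" using ne by auto
  finally show "\<Union> X // t = X" .
  have "\<Union> X \<subseteq> V" using X quotient_subset[OF assms] by blast
  moreover have "y \<in> \<Union> X" if "(x, y) \<in> t" "x \<in> \<Union> X" for x y
    using that cls by blast
  moreover have "(y, x) \<in> t" if "(x, y) \<in> t" for x y
    using assms that by (auto elim!: equivE dest: symD)
  ultimately have "\<Union> X \<subseteq> V" "saturated t (\<Union> X)"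
    unfolding saturated_def by blast+
  then show "\<Union> X \<in> {I \<in> Pow V. saturated t I}" by blast
qed simp

text \<open>The double sum over splittings \<open>I\<close> and relations on the two parts becomes a sum
  over \<open>t\<close> and saturated \<open>I\<close>; exchanging the order and replacing
  \<open>I\<close> by its set of classes gives the splittings of \<open>G/t\<close>.\<close>

lemma cointeraction_bas:
  "m_1_3_24 (tmap delta delta (Delta (bas C))) = tmap Delta id (delta (bas C))"
proof -
  obtain G :: "nat graph" where G: "is_graph G" and C: "C = isoclass G" by (rule isoclass_cases)
  let ?V = "verts G" and ?c = "\<lambda>t X. isoclass (induced (contract G t) X)"
  let ?F = "\<lambda>t X. bas ((?c t X, ?c t (?V // t - X)), isoclass (cut G t))"
  let ?f = "\<lambda>I J r s. bas ((isoclass (contract (induced G I) r), isoclass (contract (induced G J) s)),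
      isoclass (cut (induced G I) r) + isoclass (cut (induced G J) s))"
  have fin: "finite ?V" using G by (simp add: is_graph_def)
  have "m_1_3_24 (tmap delta delta (Delta (bas C))) = (\<Sum>I\<in>Pow ?V.
      m_1_3_24 (delta (bas (isoclass (induced G I))) \<otimes> delta (bas (isoclass (induced G (?V - I))))))"
    by (simp add: C Delta_isoclass_Pow[OF G] linear_map_sum linear_map_tmap linear_map_m_1_3_24 tmap_bas)
  also have "\<dots> = (\<Sum>I\<in>Pow ?V. \<Sum>r\<in>admissible (induced G I).
      \<Sum>s\<in>admissible (induced G (?V - I)). ?f I (?V - I) r s)"
    by (intro sum.cong refl)
      (simp add: delta_isoclass_admissible is_graph_induced[OF G]
      linear_map_sum[OF linear_map_tensor_left[OF linear_map_id(2)]]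
      linear_map_sum[OF linear_map_tensor_right[OF linear_map_id(2)]]
      tensor_bas linear_map_sum[OF linear_map_m_1_3_24] m_1_3_24_bas, rule sum.swap)
  also have "\<dots> = (\<Sum>I\<in>Pow ?V. \<Sum>t\<in>{t \<in> admissible G. saturated t I}.
      ?f I (?V - I) (Restr t I) (Restr t (?V - I)))"
    by (intro sum.cong refl sum_saturated) auto
  also have "\<dots> = (\<Sum>I\<in>Pow ?V. \<Sum>t\<in>{t \<in> admissible G. saturated t I}. ?F t (I // t))"
  proof (intro sum.cong refl)
    fix I t assume "I \<in> Pow ?V" "t \<in> {t \<in> admissible G. saturated t I}"
    then have t: "I \<subseteq> ?V" "saturated t I" "equiv ?V t" by (auto simp: admissible_def)
    have "contract (induced G I) (Restr t I) = induced (contract G t) (I // t)"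
      using induced_contract[OF t(1,2)] by simp
    moreover have "contract (induced G (?V - I)) (Restr t (?V - I)) =
        induced (contract G t) (?V // t - I // t)"
      using induced_contract[OF Diff_subset saturated_Compl[OF t(2,3)]] quotient_Diff[OF t(3,1,2)] by simp
    ultimately show "?f I (?V - I) (Restr t I) (Restr t (?V - I)) = ?F t (I // t)"
      using isoclass_cut_saturated[OF t(1,2) G] by simp
  qed
  also have "\<dots> = (\<Sum>t\<in>admissible G. \<Sum>I\<in>{I \<in> Pow ?V. saturated t I}. ?F t (I // t))"
    by (rule sum.swap_restrict) (simp_all add: fin finite_admissible[OF G])
  also have "\<dots> = (\<Sum>t\<in>admissible G. \<Sum>X\<in>Pow (?V // t). ?F t X)"
    using sum_Pow_quotient[OF admissible_equiv] by (intro sum.cong refl)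
  also have "\<dots> = tmap Delta id (delta (bas C))"
    by (simp add: C delta_isoclass_admissible[OF G] linear_map_sum linear_map_tmap tmap_bas
        Delta_isoclass_Pow is_graph_contract[OF G admissible_equiv] tensor_bas
        linear_map_sum[OF linear_map_tensor_left[OF linear_map_id(2)]])
  finally show ?thesis .
qed

section \<open>Nested relations and the coassociativity of \<open>delta\<close>\<close>

text \<open>For \<open>r \<subseteq> t\<close> the relations \<open>t/r\<close> on classes of
  \<open>r\<close> and, in the other direction, the pullback to \<open>V\<close> of a relation
  between classes of \<open>r\<close>. They are mutually inverse bijections between relations
  coarser than \<open>r\<close> and relations on the classes of \<open>r\<close>.\<close>

definition quotient_rel :: "'a rel \<Rightarrow> 'a rel \<Rightarrow> 'a set rel" where
  "quotient_rel t r = (\<lambda>(x, y). (r `` {x}, r `` {y})) ` t"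

definition pullback_rel :: "'a set \<Rightarrow> 'a rel \<Rightarrow> 'a set rel \<Rightarrow> 'a rel" where
  "pullback_rel V r s = {(x, y) \<in> V \<times> V. (r `` {x}, r `` {y}) \<in> s}"

lemma quotient_rel_iff:
  assumes "equiv V r" "equiv V t" "r \<subseteq> t" "x \<in> V" "y \<in> V"
  shows "(r `` {x}, r `` {y}) \<in> quotient_rel t r \<longleftrightarrow> (x, y) \<in> t"
proof
  assume "(r `` {x}, r `` {y}) \<in> quotient_rel t r"
  then obtain a b where ab: "(a, b) \<in> t" "r `` {x} = r `` {a}" "r `` {y} = r `` {b}"
    by (auto simp: quotient_rel_def)
  then have "a \<in> V" "b \<in> V" using assms(2) by (auto elim: equivE)
  then have "(x, a) \<in> t" "(y, b) \<in> t"
    using ab assms by (auto simp: class_eq_iff)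
  then show "(x, y) \<in> t" using ab(1) assms(2) by (meson equiv_def symD transD)
qed (force simp: quotient_rel_def)

lemma equiv_pullback_rel:
  assumes "equiv V r" "equiv (V // r) s"
  shows "equiv V (pullback_rel V r s)" "r \<subseteq> pullback_rel V r s"
proof -
  have s: "refl_on (V // r) s" "sym s" "trans s" using assms(2) by (auto elim: equivE)
  show "equiv V (pullback_rel V r s)"
  proof (rule equivI)
    show "refl_on V (pullback_rel V r s)"
      using s(1) by (auto simp: refl_on_def pullback_rel_def quotientI)
    show "sym (pullback_rel V r s)" using s(2) by (auto simp: sym_def pullback_rel_def)
    show "trans (pullback_rel V r s)"
      using s(3) unfolding trans_def pullback_rel_def by blast
  qed (auto simp: pullback_rel_def)
  show "r \<subseteq> pullback_rel V r s"
  proof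
    fix p assume p: "p \<in> r"
    obtain x y where xy: "p = (x, y)" by (cases p)
    then have V: "x \<in> V" "y \<in> V" using p assms(1) by (auto elim: equivE)
    then have "r `` {x} = r `` {y}" using class_eq_iff[OF assms(1)] p xy by blast
    then show "p \<in> pullback_rel V r s"
      using s(1) V xy by (auto simp: pullback_rel_def refl_on_def quotientI)
  qed
qed

lemma equiv_quotient_rel:
  assumes "equiv V r" "equiv V t" "r \<subseteq> t"
  shows "equiv (V // r) (quotient_rel t r)"
proof -
  have t: "t \<subseteq> V \<times> V" "refl_on V t" "sym t" "trans t" using assms(2) by (auto elim: equivE)
  note iff = quotient_rel_iff[OF assms]
  show ?thesis
  proof (rule equivI)
    show sub: "quotient_rel t r \<subseteq> (V // r) \<times> (V // r)"
      using t(1) by (auto simp: quotient_rel_def quotientI)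
    show "refl_on (V // r) (quotient_rel t r)"
      using t(2) iff by (auto simp: refl_on_def elim!: quotientE)
    show "sym (quotient_rel t r)" using t(3) by (force simp: sym_def quotient_rel_def)
    show "trans (quotient_rel t r)"
    proof (rule transI)
      fix c d e assume cd: "(c, d) \<in> quotient_rel t r" and de: "(d, e) \<in> quotient_rel t r"
      obtain x where x: "x \<in> V" "c = r `` {x}" using cd sub by (blast elim: quotientE)
      obtain y where y: "y \<in> V" "d = r `` {y}" using cd sub by (blast elim: quotientE)
      obtain z where z: "z \<in> V" "e = r `` {z}" using de sub by (blast elim: quotientE)
      show "(c, e) \<in> quotient_rel t r"
        using cd de transD[OF t(4)] unfolding x(2) y(2) z(2) iff[OF x(1) y(1)] iff[OF y(1) z(1)] iff[OF x(1) z(1)] by blast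
    qed
  qed
qed

lemma quotient_pullback:
  assumes "equiv V r" "equiv (V // r) s"
  shows "quotient_rel (pullback_rel V r s) r = s"
proof
  show "quotient_rel (pullback_rel V r s) r \<subseteq> s"
    by (auto simp: quotient_rel_def pullback_rel_def)
  show "s \<subseteq> quotient_rel (pullback_rel V r s) r"
  proof
    fix p assume p: "p \<in> s"
    obtain c d where cd: "p = (c, d)" by (cases p)
    have "s \<subseteq> (V // r) \<times> (V // r)" using assms(2) by (rule equivE)
    then have "c \<in> V // r" "d \<in> V // r" using p cd by auto
    then obtain x y where "x \<in> V" "c = r `` {x}" "y \<in> V" "d = r `` {y}" by (blast elim: quotientE)
    then show "p \<in> quotient_rel (pullback_rel V r s) r"
      using p cd by (force simp: quotient_rel_def pullback_rel_def)
  qed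
qed

lemma pullback_quotient:
  assumes "equiv V r" "equiv V t" "r \<subseteq> t"
  shows "pullback_rel V r (quotient_rel t r) = t"
proof -
  have "t \<subseteq> V \<times> V" using assms(2) by (rule equivE)
  then show ?thesis using quotient_rel_iff[OF assms] by (auto simp: pullback_rel_def)
qed

lemma Union_quotient_rel_class:
  assumes "equiv V r" "equiv V t" "r \<subseteq> t" "x \<in> V"
  shows "\<Union> (quotient_rel t r `` {r `` {x}}) = t `` {x}"
proof
  have t: "t \<subseteq> V \<times> V" using assms(2) by (rule equivE)
  show "t `` {x} \<subseteq> \<Union> (quotient_rel t r `` {r `` {x}})"
  proof
    fix y assume "y \<in> t `` {x}"
    then have y: "(x, y) \<in> t" "y \<in> V" using t by auto
    then have "r `` {y} \<in> quotient_rel t r `` {r `` {x}}"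
      using quotient_rel_iff[OF assms] by simp
    then show "y \<in> \<Union> (quotient_rel t r `` {r `` {x}})"
      using equiv_class_self[OF assms(1) y(2)] by blast
  qed
  show "\<Union> (quotient_rel t r `` {r `` {x}}) \<subseteq> t `` {x}"
  proof
    fix y assume "y \<in> \<Union> (quotient_rel t r `` {r `` {x}})"
    then obtain c where c: "(r `` {x}, c) \<in> quotient_rel t r" "y \<in> c" by auto
    then have "c \<in> V // r" using equiv_quotient_rel[OF assms(1-3)] by (auto elim: equivE)
    then have "c = r `` {y}" "y \<in> V"
      using class_of_member[OF assms(1) _ c(2)] quotient_subset[OF assms(1)] c(2) by auto
    then show "y \<in> t `` {x}"
      using c(1) quotient_rel_iff[OF assms] by simp
  qed
qed

lemma bij_betw_Union_quotient_rel:
  assumes "equiv V r" "equiv V t" "r \<subseteq> t"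
  shows "bij_betw Union ((V // r) // quotient_rel t r) (V // t)"
proof -
  let ?q = "quotient_rel t r"
  note U = Union_quotient_rel_class[OF assms]
  have Q: "(V // r) // ?q = (\<lambda>x. ?q `` {r `` {x}}) ` V" by (auto simp: quotient_def)
  have "?q `` {r `` {x}} = ?q `` {r `` {y}}" if "x \<in> V" "y \<in> V" "t `` {x} = t `` {y}" for x y
  proof -
    have "(x, y) \<in> t" using that class_eq_iff[OF assms(2)] by blast
    then have "(r `` {x}, r `` {y}) \<in> ?q" using quotient_rel_iff[OF assms] that by blast
    then show ?thesis by (rule equiv_class_eq[OF equiv_quotient_rel[OF assms]])
  qed
  note classes_eq = this
  have "inj_on Union ((V // r) // ?q)"
  proof (rule inj_onI)
    fix C D assume "C \<in> (V // r) // ?q" "D \<in> (V // r) // ?q" and CD: "\<Union> C = \<Union> D"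
    then obtain x y where "x \<in> V" "C = ?q `` {r `` {x}}" "y \<in> V" "D = ?q `` {r `` {y}}"
      unfolding Q by blast
    then show "C = D" using classes_eq CD U by metis
  qed
  moreover have "Union ` ((V // r) // ?q) = V // t"
    unfolding Q image_image using U by (auto simp: quotient_def)
  ultimately show ?thesis by (simp add: bij_betw_def)
qed

text \<open>The analogue of the third isomorphism theorem: a class of \<open>t/r\<close> is a set of
  classes of \<open>r\<close>, and its union is the corresponding class of \<open>t\<close>.\<close>

lemma iso_by_contract_contract:
  assumes "equiv (verts G) r" "equiv (verts G) t" "r \<subseteq> t"
  shows "iso_by Union (contract (contract G r) (quotient_rel t r)) (contract G t)"
proof -
  let ?Q = "(verts G // r) // quotient_rel t r"
  note bij = bij_betw_Union_quotient_rel[OF assms]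
  then have inj: "inj_on Union ?Q" and im: "verts G // t = Union ` ?Q" by (auto simp: bij_betw_def)
  note eqs = equiv_quotient_rel[OF assms]
  have E: "(\<exists>c\<in>C. \<exists>d\<in>D. {c, d} \<in> edges (contract G r)) \<longleftrightarrow>
      (\<exists>x\<in>\<Union> C. \<exists>y\<in>\<Union> D. {x, y} \<in> edges G)" if "C \<in> ?Q" "D \<in> ?Q" "C \<noteq> D" for C D
  proof
    assume "\<exists>c\<in>C. \<exists>d\<in>D. {c, d} \<in> edges (contract G r)"
    then obtain c d where cd: "c \<in> C" "d \<in> D" "{c, d} \<in> edges (contract G r)" by blast
    then obtain c' d' x y where *: "{c, d} = {c', d'}" "x \<in> c'" "y \<in> d'" "{x, y} \<in> edges G"
      by (auto simp: contract_def)
    then have "(x \<in> c \<and> y \<in> d) \<or> (y \<in> c \<and> x \<in> d)" by (auto simp: doubleton_eq_iff)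
    then show "\<exists>x\<in>\<Union> C. \<exists>y\<in>\<Union> D. {x, y} \<in> edges G"
      using cd(1,2) *(4) by (metis UnionI insert_commute)
  next
    assume "\<exists>x\<in>\<Union> C. \<exists>y\<in>\<Union> D. {x, y} \<in> edges G"
    then obtain c d x y where *: "c \<in> C" "d \<in> D" "x \<in> c" "y \<in> d" "{x, y} \<in> edges G" by blast
    \<comment> \<open>Distinct classes of \<open>t/r\<close> share no class of \<open>r\<close>, so the edge is not lost when contracting by \<open>r\<close>.\<close>
    have "C \<inter> D = {}" using quotient_disj[OF eqs that(1,2)] that(3) by blast
    then have "c \<noteq> d" using * by blast
    moreover have "c \<in> verts G // r" "d \<in> verts G // r"
      using quotient_subset[OF eqs] that * by blast+
    ultimately have "{c, d} \<in> edges (contract G r)"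
      using * by (auto simp: contract_def)
    then show "\<exists>c\<in>C. \<exists>d\<in>D. {c, d} \<in> edges (contract G r)" using * by blast
  qed
  have "edges (contract G t) = {{\<Union> C, \<Union> D} |C D. C \<in> ?Q \<and> D \<in> ?Q \<and> \<Union> C \<noteq> \<Union> D \<and>
      (\<exists>x\<in>\<Union> C. \<exists>y\<in>\<Union> D. {x, y} \<in> edges G)}"
    unfolding contract_def im by (simp only: snd_conv) blast
  also have "\<dots> = {{\<Union> C, \<Union> D} |C D. C \<in> ?Q \<and> D \<in> ?Q \<and> C \<noteq> D \<and>
      (\<exists>c\<in>C. \<exists>d\<in>D. {c, d} \<in> edges (contract G r))}"
    using E inj_on_eq_iff[OF inj] by (intro Collect_cong ex_cong1 conj_cong refl) auto
  also have "\<dots> = (\<lambda>e. Union ` e) ` edges (contract (contract G r) (quotient_rel t r))"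
    by (simp add: contract_def[of "contract G r"] image_Collect2)
  finally show ?thesis
    using bij by (simp add: iso_by_def)
qed

lemma cut_contract:
  assumes "equiv (verts G) r" "equiv (verts G) t" "r \<subseteq> t"
  shows "cut (contract G r) (quotient_rel t r) = contract (cut G t) r"
proof (rule prod_eqI)
  have mem: "(c, d) \<in> quotient_rel t r \<longleftrightarrow> (x, y) \<in> t"
    if "c \<in> verts G // r" "d \<in> verts G // r" "x \<in> c" "y \<in> d" for c d x y
  proof -
    have "c = r `` {x}" "d = r `` {y}"
      using class_of_member[OF assms(1)] that by blast+
    moreover have "x \<in> verts G" "y \<in> verts G"
      using quotient_subset[OF assms(1)] that by blast+
    ultimately show ?thesis using quotient_rel_iff[OF assms] by simp
  qed
  have "sym t" using assms(2) by (rule equivE)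
  then have cut_edge: "{x, y} \<in> edges (cut G t) \<longleftrightarrow> {x, y} \<in> edges G \<and> (x, y) \<in> t" for x y
    unfolding cut_edge_iff by (blast dest: symD)
  have "edges (cut (contract G r) (quotient_rel t r)) =
      {{c, d} |c d. {c, d} \<in> edges (contract G r) \<and> (c, d) \<in> quotient_rel t r}"
    by (simp add: cut_def)
  also have "\<dots> = {{c, d} |c d. {c, d} \<in> edges (contract (cut G t) r)}"
  proof -
    have "{c, d} \<in> edges (contract G r) \<and> (c, d) \<in> quotient_rel t r \<longleftrightarrow>
        {c, d} \<in> edges (contract (cut G t) r)" for c d
      unfolding contract_edge_iff cut_edge verts_simps using mem by blast
    then show ?thesis by simp
  qed
  also have "\<dots> = edges (contract (cut G t) r)"
    unfolding contract_edge_iff by (simp add: contract_def)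
  finally show "edges (cut (contract G r) (quotient_rel t r)) = edges (contract (cut G t) r)" .
qed simp

abbreviation reach :: "'a graph \<Rightarrow> 'a rel" where
  "reach G \<equiv> {(u, v). {u, v} \<in> edges G}\<^sup>*"

lemma reach_mono: "edges G \<subseteq> edges H \<Longrightarrow> reach G \<subseteq> reach H"
  by (rule rtrancl_mono) blast

text \<open>A path in \<open>G\<close> projects to a path of classes, with repetitions where it stays
  inside a class. Conversely an edge between two classes comes from an edge of
  \<open>G\<close>, and its ends are joined to all other vertices of these classes because the
  classes are connected.\<close>

lemma connected_Union_classes:
  assumes "r \<in> admissible G" "C \<subseteq> verts G // r"
  shows "connected_graph (induced G (\<Union> C)) \<longleftrightarrow> connected_graph (induced (contract G r) C)"
proof -
  have eq: "equiv (verts G) r" and con: "\<And>c. c \<in> verts G // r \<Longrightarrow> connected_graph (induced G c)"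
    using assms(1) by (auto simp: admissible_def)
  have cls: "r `` {x} = c" if "x \<in> c" "c \<in> C" for x c
    using class_of_member[OF eq _ that(1)] that(2) assms(2) by blast
  have ne: "c \<noteq> {}" if "c \<in> C" for c
    using in_quotient_imp_non_empty[OF eq] that assms(2) by blast
  show ?thesis
  proof
    assume L: "connected_graph (induced G (\<Union> C))"
    have path: "(r `` {x}, r `` {y}) \<in> reach (induced (contract G r) C)"
      if "(x, y) \<in> reach (induced G (\<Union> C))" for x y
      using that
    proof (induction rule: rtrancl_induct)
      case (step y z)
      then have yz: "{y, z} \<in> edges G" "y \<in> \<Union> C" "z \<in> \<Union> C" by (auto simp: induced_def)
      then obtain c d where cd: "c \<in> C" "y \<in> c" "d \<in> C" "z \<in> d" by blast
      have "{c, d} \<in> edges (induced (contract G r) C)" if "c \<noteq> d"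
        using that cd yz(1) assms(2) by (auto simp: induced_def contract_edge_iff)
      then show ?case
        using step.IH cls[OF cd(2,1)] cls[OF cd(4,3)] by (cases "c = d") (auto intro: rtrancl_into_rtrancl)
    qed simp
    have "(c, d) \<in> reach (induced (contract G r) C)" if cd: "c \<in> C" "d \<in> C" for c d
    proof -
      obtain x y where xy: "x \<in> c" "y \<in> d" using ne[OF cd(1)] ne[OF cd(2)] by blast
      then have "(x, y) \<in> reach (induced G (\<Union> C))"
        using L cd by (auto simp: connected_graph_def)
      then show ?thesis using path cls[OF xy(1) cd(1)] cls[OF xy(2) cd(2)] by force
    qed
    moreover have "C \<noteq> {}" using L by (auto simp: connected_graph_def)
    ultimately show "connected_graph (induced (contract G r) C)"
      by (simp add: connected_graph_def)
  next
    assume R: "connected_graph (induced (contract G r) C)"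
    have inner: "(x, y) \<in> reach (induced G (\<Union> C))" if "c \<in> C" "x \<in> c" "y \<in> c" for c x y
    proof -
      have "(x, y) \<in> reach (induced G c)"
        using con[of c] that assms(2) by (auto simp: connected_graph_def)
      moreover have "edges (induced G c) \<subseteq> edges (induced G (\<Union> C))"
        using that(1) by (auto simp: induced_def)
      ultimately show ?thesis using reach_mono by blast
    qed
    have path: "\<forall>y\<in>d. (x, y) \<in> reach (induced G (\<Union> C))"
      if "(c, d) \<in> reach (induced (contract G r) C)" "c \<in> C" "x \<in> c" for c d x
      using that(1)
    proof (induction rule: rtrancl_induct)
      case base
      then show ?case using inner that by blast
    next
      case (step d e)
      then have de: "{d, e} \<in> edges (contract G r)" "d \<in> C" "e \<in> C" by (auto simp: induced_def)
      then obtain u v where uv: "u \<in> d" "v \<in> e" "{u, v} \<in> edges G" by (auto simp: contract_edge_iff)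
      then have "{u, v} \<in> edges (induced G (\<Union> C))" using de by (auto simp: induced_def)
      then have "(x, v) \<in> reach (induced G (\<Union> C))"
        using step.IH uv(1) by (auto intro: rtrancl_into_rtrancl)
      then show ?case using inner[OF de(3) uv(2)] by (auto intro: rtrancl_trans)
    qed
    have "\<Union> C \<noteq> {}" using R ne by (auto simp: connected_graph_def)
    moreover have "(x, y) \<in> reach (induced G (\<Union> C))" if "x \<in> \<Union> C" "y \<in> \<Union> C" for x y
      using that path R by (fastforce simp: connected_graph_def)
    ultimately show "connected_graph (induced G (\<Union> C))"
      by (simp add: connected_graph_def)
  qed
qed

lemma admissible_quotient_rel_iff:
  assumes "r \<in> admissible G" "equiv (verts G) t" "r \<subseteq> t"
  shows "quotient_rel t r \<in> admissible (contract G r) \<longleftrightarrow> t \<in> admissible G"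
proof -
  have eq: "equiv (verts G) r" by (rule admissible_equiv[OF assms(1)])
  note e = equiv_quotient_rel[OF eq assms(2,3)]
  have "verts G // t = Union ` ((verts G // r) // quotient_rel t r)"
    using bij_betw_Union_quotient_rel[OF eq assms(2,3)] by (simp add: bij_betw_def)
  then show ?thesis
    using connected_Union_classes[OF assms(1) quotient_subset[OF e]] e assms(2)
    by (simp add: admissible_def)
qed

text \<open>Cutting along a coarser relation deletes no edge inside a class of \<open>r\<close>; this is
  why admissibility of \<open>r\<close> does not see the cut.\<close>

lemma induced_cut_class:
  assumes "is_graph G" "equiv V r" "r \<subseteq> t" "c \<in> V // r"
  shows "induced (cut G t) c = induced G c"
proof (rule prod_eqI)
  have "(x, y) \<in> t" if "x \<in> c" "y \<in> c" for x y
    using in_quotient_imp_in_rel[OF assms(2,4)] that assms(3) by blast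
  then have "e \<in> edges (cut G t)" if "e \<in> edges G" "e \<subseteq> c" for e
    using edge_pair[OF assms(1) that(1)] that by (auto simp: cut_edge_iff)
  moreover have "edges (cut G t) \<subseteq> edges G" by (auto simp: cut_def)
  ultimately show "edges (induced (cut G t) c) = edges (induced G c)"
    by (auto simp: induced_def)
qed simp

lemma admissible_cut_iff:
  assumes "is_graph G" "r \<subseteq> t"
  shows "r \<in> admissible (cut G t) \<longleftrightarrow> r \<in> admissible G"
  using induced_cut_class[OF assms(1) _ assms(2)] by (auto simp: admissible_def)

lemma reach_cut_subset:
  assumes "equiv (verts G) t" "(x, y) \<in> reach (induced (cut G t) c)" "x \<in> verts G"
  shows "(x, y) \<in> t"
  using assms(2)
proof (induction rule: rtrancl_induct)
  case base
  then show ?case using assms(1,3) by (auto elim!: equivE simp: refl_on_def)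
next
  case (step y z)
  have t: "sym t" "trans t" using assms(1) by (auto elim: equivE)
  from step have "(y, z) \<in> t \<or> (z, y) \<in> t"
    by (auto simp: induced_def cut_def doubleton_eq_iff)
  then have "(y, z) \<in> t" using symD[OF t(1)] by blast
  then show ?case using step.IH transD[OF t(2)] by blast
qed

text \<open>A path in \<open>G|t\<close> never leaves a class of \<open>t\<close>, so classes that are
  connected in \<open>G|t\<close> refine those of \<open>t\<close>.\<close>

lemma admissible_cut_subset:
  assumes "equiv (verts G) t" "r \<in> admissible (cut G t)"
  shows "r \<subseteq> t"
proof
  fix p assume p: "p \<in> r"
  obtain x y where xy: "p = (x, y)" by (cases p)
  have r: "equiv (verts G) r"
    "\<And>c. c \<in> verts G // r \<Longrightarrow> connected_graph (induced (cut G t) c)"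
    using assms(2) by (auto simp: admissible_def)
  have x: "x \<in> verts G" using p xy r(1) by (auto elim: equivE)
  then have "connected_graph (induced (cut G t) (r `` {x}))" "x \<in> r `` {x}" "y \<in> r `` {x}"
    using r(2) p xy equiv_class_self[OF r(1)] by (auto simp: quotientI)
  then have "(x, y) \<in> reach (induced (cut G t) (r `` {x}))"
    by (simp add: connected_graph_def)
  then show "p \<in> t" using reach_cut_subset[OF assms(1) _ x] xy by blast
qed

text \<open>Both sides count the pairs of admissible relations \<open>r \<subseteq> t\<close>: on the
  left \<open>t\<close> is recorded as the relation \<open>s = t/r\<close> on
  \<open>G/r\<close>, on the right \<open>r\<close> as an admissible relation of
  \<open>G|t\<close>.\<close>

lemma delta_coassoc_bas:
  "assoc (tmap delta id (delta (bas C))) = tmap id delta (delta (bas C))"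
proof -
  obtain G :: "nat graph" where G: "is_graph G" and C: "C = isoclass G" by (rule isoclass_cases)
  let ?V = "verts G" and ?adm = "admissible G"
  let ?L = "\<lambda>r s. bas (isoclass (contract (contract G r) s), isoclass (cut (contract G r) s), isoclass (cut G r))"
  let ?R = "\<lambda>t r. bas (isoclass (contract G t), isoclass (contract (cut G t) r), isoclass (cut (cut G t) r))"
  have gc: "is_graph (contract G r)" if "r \<in> ?adm" for r
    using is_graph_contract[OF G admissible_equiv[OF that]] .
  have "assoc (tmap delta id (delta (bas C))) = (\<Sum>r\<in>?adm. \<Sum>s\<in>admissible (contract G r). ?L r s)"
    by (simp add: C delta_isoclass_admissible[OF G] linear_map_sum linear_map_tmap tmap_bas
        delta_isoclass_admissible gc tensor_bas linear_map_assoc assoc_bas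
        linear_map_sum[OF linear_map_tensor_left[OF linear_map_id(2)]])
  also have "\<dots> = (\<Sum>(r, s)\<in>(SIGMA r:?adm. admissible (contract G r)). ?L r s)"
    by (rule sum.Sigma) (auto simp: finite_admissible G gc)
  also have "\<dots> = (\<Sum>(t, r)\<in>(SIGMA t:?adm. admissible (cut G t)). ?R t r)"
  proof (rule sum.reindex_bij_witness[where i = "\<lambda>(t, r). (r, quotient_rel t r)"
        and j = "\<lambda>(r, s). (pullback_rel ?V r s, r)"])
    fix p assume "p \<in> (SIGMA r:?adm. admissible (contract G r))"
    then obtain r s where p: "p = (r, s)" "r \<in> ?adm" "s \<in> admissible (contract G r)" by auto
    have eq: "equiv ?V r" "equiv (?V // r) s"
      using admissible_equiv[OF p(2)] admissible_equiv[OF p(3)] by simp_all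
    define t where "t = pullback_rel ?V r s"
    have t: "equiv ?V t" "r \<subseteq> t" and s: "s = quotient_rel t r"
      unfolding t_def using equiv_pullback_rel[OF eq] quotient_pullback[OF eq] by simp_all
    show "(case case p of (r, s) \<Rightarrow> (pullback_rel ?V r s, r) of (t, r) \<Rightarrow> (r, quotient_rel t r)) = p"
      by (simp add: p(1) t_def[symmetric] s[symmetric])
    show "(case p of (r, s) \<Rightarrow> (pullback_rel ?V r s, r)) \<in> (SIGMA t:?adm. admissible (cut G t))"
      using p(3) admissible_quotient_rel_iff[OF p(2) t]
      by (simp add: p(1,2) t_def[symmetric] admissible_cut_iff[OF G t(2)] s[symmetric])
    have "isoclass (contract (contract G r) s) = isoclass (contract G t)"
      using isoclass_eqI[OF iso_by_contract_contract[OF eq(1) t]] is_graph_contract[OF gc[OF p(2)]] eq(2)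
      by (simp add: s[symmetric])
    moreover have "cut (contract G r) s = contract (cut G t) r"
      unfolding s by (rule cut_contract[OF eq(1) t])
    ultimately have "?R t r = ?L r s"
      by (simp add: cut_cut[OF t(2)])
    then show "(case case p of (r, s) \<Rightarrow> (pullback_rel ?V r s, r) of (t, r) \<Rightarrow> ?R t r) =
        (case p of (r, s) \<Rightarrow> ?L r s)"
      by (simp add: p(1) t_def)
  next
    fix p assume "p \<in> (SIGMA t:?adm. admissible (cut G t))"
    then obtain t r where p: "p = (t, r)" "t \<in> ?adm" "r \<in> admissible (cut G t)" by auto
    have t: "equiv ?V t" by (rule admissible_equiv[OF p(2)])
    have sub: "r \<subseteq> t" by (rule admissible_cut_subset[OF t p(3)])
    have r: "r \<in> ?adm" using p(3) admissible_cut_iff[OF G sub] by simp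
    show "(case case p of (t, r) \<Rightarrow> (r, quotient_rel t r) of (r, s) \<Rightarrow> (pullback_rel ?V r s, r)) = p"
      using pullback_quotient[OF admissible_equiv[OF r] t sub] by (simp add: p(1))
    show "(case p of (t, r) \<Rightarrow> (r, quotient_rel t r)) \<in> (SIGMA r:?adm. admissible (contract G r))"
      using r admissible_quotient_rel_iff[OF r t sub] p(2) by (simp add: p(1))
  qed
  also have "\<dots> = (\<Sum>t\<in>?adm. \<Sum>r\<in>admissible (cut G t). ?R t r)"
    by (rule sum.Sigma[symmetric]) (auto simp: finite_admissible G is_graph_cut)
  also have "\<dots> = tmap id delta (delta (bas C))"
    by (simp add: C delta_isoclass_admissible[OF G] linear_map_sum linear_map_tmap tmap_bas
        delta_isoclass_admissible is_graph_cut[OF G] tensor_bas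
        linear_map_sum[OF linear_map_tensor_right[OF linear_map_id(2)]])
  finally show ?thesis .
qed

section \<open>The counit of \<open>delta\<close>\<close>

lift_definition edgeless :: "isograph \<Rightarrow> bool" is "\<lambda>G. edges G = {}"
  by (auto simp: isomorphic_def iso_by_def)

lemma edgeless_isoclass:
  assumes "is_graph G"
  shows "edgeless (isoclass G) \<longleftrightarrow> edges G = {}"
proof -
  obtain H where H: "is_graph H" "isomorphic G H" "isoclass G = abs_isograph H"
    using isoclass_ex[OF assms] by blast
  have "edgeless (isoclass G) \<longleftrightarrow> edges H = {}"
    using edgeless.abs_eq[of H] H(1,3) by (simp add: isomorphic_refl)
  then show ?thesis using H(2) by (auto simp: isomorphic_def iso_by_def)
qed

lemma edgeless_plus: "edgeless (A + B) \<longleftrightarrow> edgeless A \<and> edgeless B"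
proof -
  obtain G :: "(nat + nat) graph" and I J where G: "is_graph G" and sep: "separated G I J"
    and A: "A = isoclass (induced G I)" and B: "B = isoclass (induced G J)"
    by (rule isoclass_plus_cases)
  have "I \<subseteq> verts G" "J \<subseteq> verts G" using sep by (auto simp: separated_def)
  then have "edgeless A \<longleftrightarrow> {e \<in> edges G. e \<subseteq> I} = {}" "edgeless B \<longleftrightarrow> {e \<in> edges G. e \<subseteq> J} = {}"
    by (simp_all add: A B edgeless_isoclass is_graph_induced[OF G]) (simp_all add: induced_def)
  moreover have "edgeless (A + B) \<longleftrightarrow> edges G = {}"
    by (simp add: A B isoclass_separated[OF G sep, symmetric] edgeless_isoclass[OF G])
  moreover have "e \<subseteq> I \<or> e \<subseteq> J" if "e \<in> edges G" for e
    using sep that by (simp add: separated_def)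
  ultimately show ?thesis by blast
qed

lemma edgeless_0: "edgeless 0"
  unfolding zero_isograph_def by (subst edgeless_isoclass) (simp_all add: is_graph_def)

text \<open>Contraction keeps exactly the edges between different classes.\<close>

lemma edges_contract_empty_iff:
  assumes "is_graph G" "equiv (verts G) r"
  shows "edges (contract G r) = {} \<longleftrightarrow> (\<forall>x y. {x, y} \<in> edges G \<longrightarrow> (x, y) \<in> r)"
proof
  assume L: "edges (contract G r) = {}"
  show "\<forall>x y. {x, y} \<in> edges G \<longrightarrow> (x, y) \<in> r"
  proof (intro allI impI)
    fix x y assume e: "{x, y} \<in> edges G"
    then have V: "x \<in> verts G" "y \<in> verts G" using edge_ends[OF assms(1)] by auto
    have "{r `` {x}, r `` {y}} \<notin> edges (contract G r)" using L by simp
    then have "r `` {x} = r `` {y}"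
      using e V equiv_class_self[OF assms(2)] unfolding contract_edge_iff by (blast intro: quotientI)
    then show "(x, y) \<in> r" using class_eq_iff[OF assms(2) V] by simp
  qed
next
  assume R: "\<forall>x y. {x, y} \<in> edges G \<longrightarrow> (x, y) \<in> r"
  have "c = d" if "c \<in> verts G // r" "d \<in> verts G // r" "x \<in> c" "y \<in> d" "{x, y} \<in> edges G" for c d x y
    using R that quotient_eqI[OF assms(2)] by blast
  then show "edges (contract G r) = {}" unfolding contract_def by auto
qed

definition components :: "'a graph \<Rightarrow> 'a rel" where
  "components G = reach G \<inter> verts G \<times> verts G"

lemma sym_reach: "sym (reach G)"
  by (rule sym_rtrancl) (auto simp: sym_def insert_commute)

text \<open>Since a path starting in a component stays in it, connecting paths survive in the induced
  subgraph.\<close>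

lemma admissible_components:
  assumes "is_graph G"
  shows "components G \<in> admissible G"
proof -
  have e: "equiv (verts G) (components G)"
  proof (rule equivI)
    show "refl_on (verts G) (components G)" by (auto simp: components_def refl_on_def)
    show "sym (components G)" using sym_reach[of G] unfolding components_def sym_def by blast
    show "trans (components G)"
      using trans_rtrancl[of "{(u, v). {u, v} \<in> edges G}"] unfolding components_def trans_def by blast
  qed (auto simp: components_def)
  have "connected_graph (induced G c)" if "c \<in> verts G // components G" for c
  proof -
    have "(x, y) \<in> reach (induced G c)" if x: "x \<in> c" and "y \<in> c" for x y
    proof -
      have "x \<in> verts G" using x \<open>c \<in> verts G // components G\<close> quotient_subset[OF e] by blast
      have "(x, y) \<in> reach G"
        using in_quotient_imp_in_rel[OF e \<open>c \<in> verts G // components G\<close>] that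
        by (auto simp: components_def)
      then have "(x, y) \<in> reach (induced G c) \<and> y \<in> c"
      proof (induction rule: rtrancl_induct)
        case (step y z)
        then have "(y, z) \<in> components G"
          using edge_ends[OF assms] by (auto simp: components_def)
        then have "z \<in> c"
          using in_quotient_imp_closed[OF e \<open>c \<in> verts G // components G\<close>] step.IH by blast
        then have "{y, z} \<in> edges (induced G c)" using step by (auto simp: induced_def)
        then show ?case using step.IH \<open>z \<in> c\<close> by (auto intro: rtrancl_into_rtrancl)
      qed (use x in auto)
      then show ?thesis ..
    qed
    then show ?thesis
      using in_quotient_imp_non_empty[OF e that] by (simp add: connected_graph_def)
  qed
  then show ?thesis using e by (simp add: admissible_def)
qed

lemma admissible_subset_components:
  assumes "r \<in> admissible G"
  shows "r \<subseteq> components G"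
proof
  fix p assume p: "p \<in> r"
  obtain x y where xy: "p = (x, y)" by (cases p)
  have r: "equiv (verts G) r" "\<And>c. c \<in> verts G // r \<Longrightarrow> connected_graph (induced G c)"
    using assms by (auto simp: admissible_def)
  have V: "x \<in> verts G" "y \<in> verts G" using p xy r(1) by (auto elim: equivE)
  then have "connected_graph (induced G (r `` {x}))" "x \<in> r `` {x}" "y \<in> r `` {x}"
    using r(2) p xy equiv_class_self[OF r(1)] by (auto simp: quotientI)
  then have "(x, y) \<in> reach (induced G (r `` {x}))"
    by (simp add: connected_graph_def)
  moreover have "edges (induced G (r `` {x})) \<subseteq> edges G" by (auto simp: induced_def)
  ultimately show "p \<in> components G"
    using reach_mono V xy unfolding components_def by blast
qed

text \<open>Connected classes are contained in components; if no edge leaves a class, the class is also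
  closed under paths.\<close>

lemma edgeless_contract_iff:
  assumes "is_graph G" "r \<in> admissible G"
  shows "edges (contract G r) = {} \<longleftrightarrow> r = components G"
proof
  note eq = admissible_equiv[OF assms(2)]
  have t: "refl_on (verts G) r" "trans r" using eq by (auto elim: equivE)
  assume "edges (contract G r) = {}"
  then have E: "(x, y) \<in> r" if "{x, y} \<in> edges G" for x y
    using edges_contract_empty_iff[OF assms(1) eq] that by blast
  have "(x, y) \<in> r" if "(x, y) \<in> reach G" "x \<in> verts G" for x y
    using that(1)
  proof (induction rule: rtrancl_induct)
    case base
    then show ?case using t(1) that(2) by (simp add: refl_on_def)
  next
    case (step y z)
    then have "(y, z) \<in> r" using E by simp
    then show ?case using step.IH transD[OF t(2)] by blast
  qed
  then show "r = components G"
    using admissible_subset_components[OF assms(2)] by (auto simp: components_def)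
next
  assume r: "r = components G"
  have "(x, y) \<in> r" if "{x, y} \<in> edges G" for x y
    using edge_ends[OF assms(1) that] that by (auto simp: r components_def)
  then show "edges (contract G r) = {}"
    using edges_contract_empty_iff[OF assms(1) admissible_equiv[OF assms(2)]] by blast
qed

lemma cut_components:
  assumes "is_graph G"
  shows "cut G (components G) = G"
proof (rule prod_eqI)
  have "(x, y) \<in> components G" if "{x, y} \<in> edges G" for x y
    using edge_ends[OF assms that] that by (auto simp: components_def)
  then have "e \<in> edges (cut G (components G))" if "e \<in> edges G" for e
    using edge_pair[OF assms that] that by (auto simp: cut_edge_iff)
  moreover have "edges (cut G (components G)) \<subseteq> edges G" by (auto simp: cut_def)
  ultimately show "edges (cut G (components G)) = edges G" by blast
qed simp

lemma admissible_Id_on: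
  assumes "is_graph G"
  shows "Id_on (verts G) \<in> admissible G"
proof -
  have "connected_graph (induced G c)" if "c \<in> verts G // Id_on (verts G)" for c
    using that by (auto simp: quotient_def connected_graph_def)
  moreover have "equiv (verts G) (Id_on (verts G))"
    by (rule equivI) (auto simp: refl_on_def sym_def trans_def)
  ultimately show ?thesis by (simp add: admissible_def)
qed

text \<open>A class with two vertices is connected, hence contains an edge, and that edge is kept by the
  cut.\<close>

lemma edgeless_cut_iff:
  assumes "is_graph G" "r \<in> admissible G"
  shows "edges (cut G r) = {} \<longleftrightarrow> r = Id_on (verts G)"
proof
  have r: "equiv (verts G) r" "\<And>c. c \<in> verts G // r \<Longrightarrow> connected_graph (induced G c)"
    using assms(2) by (auto simp: admissible_def)
  then have V: "r \<subseteq> verts G \<times> verts G" "refl_on (verts G) r" by (auto elim: equivE)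
  assume L: "edges (cut G r) = {}"
  have "x = y" if xy: "(x, y) \<in> r" for x y
  proof -
    have x: "x \<in> verts G" using V xy by auto
    have c: "r `` {x} \<in> verts G // r" using x by (rule quotientI)
    have "edges (induced G (r `` {x})) = edges (induced (cut G r) (r `` {x}))"
      using induced_cut_class[OF assms(1) r(1) order_refl c] by simp
    also have "\<dots> = {}" using L by (simp add: induced_def)
    finally have none: "edges (induced G (r `` {x})) = {}" .
    have "(x, y) \<in> reach (induced G (r `` {x}))"
      using r(2)[OF c] xy equiv_class_self[OF r(1) x] by (simp add: connected_graph_def)
    then show "x = y" by (simp add: none)
  qed
  then show "r = Id_on (verts G)" using V by (auto simp: refl_on_def)
next
  assume "r = Id_on (verts G)"
  then show "edges (cut G r) = {}" using edge_ends[OF assms(1)] by (auto simp: cut_def)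
qed

lemma isoclass_contract_Id_on:
  assumes "is_graph G"
  shows "isoclass (contract G (Id_on (verts G))) = isoclass G"
proof -
  have Q: "verts G // Id_on (verts G) = (\<lambda>x. {x}) ` verts G"
    by (auto simp: quotient_def)
  have "edges (contract G (Id_on (verts G))) = (\<lambda>e. (\<lambda>x. {x}) ` e) ` {{x, y} |x y. {x, y} \<in> edges G}"
  proof -
    have "edges (contract G (Id_on (verts G))) = {{{x}, {y}} |x y. x \<in> verts G \<and> y \<in> verts G \<and> x \<noteq> y \<and> {x, y} \<in> edges G}"
      unfolding contract_def Q snd_conv by blast
    also have "\<dots> = {{{x}, {y}} |x y. {x, y} \<in> edges G}"
      using edge_ends[OF assms] by blast
    finally show ?thesis by (simp add: image_Collect2)
  qed
  also have "{{x, y} |x y. {x, y} \<in> edges G} = edges G"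
  proof
    show "edges G \<subseteq> {{x, y} |x y. {x, y} \<in> edges G}"
    proof
      fix e assume e: "e \<in> edges G"
      then obtain x y where "e = {x, y}" using edge_pair[OF assms] by blast
      then show "e \<in> {{x, y} |x y. {x, y} \<in> edges G}" using e by blast
    qed
  qed blast
  finally have "iso_by (\<lambda>x. {x}) G (contract G (Id_on (verts G)))"
    by (simp add: iso_by_def Q bij_betw_def)
  then show ?thesis using isoclass_eqI[OF _ assms] by metis
qed

section \<open>The two bialgebras and their cointeraction\<close>

lemma linear_map_Delta: "linear_map Delta" and linear_map_delta: "linear_map delta"
  by (simp_all add: Delta_def delta_def linear_map_lin_ext)

lemma eps_form_ext: "eps = form_ext (\<lambda>C. if C = 0 then 1 else 0)"
  by (simp add: fun_eq_iff eps_def form_ext_def)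

lemma linear_form_eps: "linear_form eps"
  unfolding eps_form_ext by (rule linear_form_form_ext)

lemma eps_bas: "eps (bas C) = (if C = 0 then 1 else 0)"
  unfolding eps_form_ext by (rule form_ext_bas)

definition counit_delta :: "HG \<Rightarrow> rat" where
  "counit_delta = form_ext (\<lambda>C. if edgeless C then 1 else 0)"

lemma linear_form_counit_delta: "linear_form counit_delta"
  unfolding counit_delta_def by (rule linear_form_form_ext)

lemma counit_delta_bas: "counit_delta (bas C) = (if edgeless C then 1 else 0)"
  unfolding counit_delta_def by (rule form_ext_bas)

lemma Delta_mult: "Delta (x * y) = Delta x * Delta y"
  by (rule bilinear_eqI[of "\<lambda>x y. Delta (x * y)" "\<lambda>x y. Delta x * Delta y"])
    (intro linear_map_intros linear_map_Delta[THEN linear_map_comp] linear_map_Delta |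
      simp add: bas_mult Delta_bas_plus)+

lemma delta_mult: "delta (x * y) = delta x * delta y"
  by (rule bilinear_eqI[of "\<lambda>x y. delta (x * y)" "\<lambda>x y. delta x * delta y"])
    (intro linear_map_intros linear_map_delta[THEN linear_map_comp] linear_map_delta |
      simp add: bas_mult delta_bas_plus)+

definition empty_graph :: "nat graph" where
  "empty_graph = ({}, {})"

lemma empty_graph_simps: "is_graph empty_graph" "isoclass empty_graph = 0" "verts empty_graph = {}"
  "edges empty_graph = {}"
  by (simp_all add: empty_graph_def is_graph_def zero_isograph_def)

lemma Delta_1: "Delta 1 = 1 \<otimes> 1"
proof -
  have "induced empty_graph {} = empty_graph"
    using induced_verts[OF empty_graph_simps(1)] by (simp add: empty_graph_simps)
  then have "Delta (bas 0) = bas (0, 0)"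
    using Delta_isoclass_Pow[OF empty_graph_simps(1)] by (simp add: empty_graph_simps)
  then show ?thesis
    by (simp flip: tensor_bas add: bas_zero)
qed

lemma delta_1: "delta 1 = 1 \<otimes> 1"
proof -
  have "admissible empty_graph = {{}}"
    by (auto simp: admissible_def empty_graph_simps equiv_def refl_on_def sym_def trans_def)
  moreover have "isoclass (contract empty_graph {}) = 0" "isoclass (cut empty_graph {}) = 0"
    by (auto simp: isoclass_eq_0_iff is_graph_cut empty_graph_simps is_graph_contract equiv_def refl_on_def sym_def trans_def)
  ultimately have "delta (bas 0) = bas (0, 0)"
    using delta_isoclass_admissible[OF empty_graph_simps(1)] by (simp add: empty_graph_simps)
  then show ?thesis
    by (simp flip: tensor_bas add: bas_zero)
qed

lemma plus_isograph_eq_0_iff: "A + B = 0 \<longleftrightarrow> A = 0 \<and> B = 0" for A B :: isograph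
proof -
  obtain G :: "(nat + nat) graph" and I J where G: "is_graph G" and sep: "separated G I J"
    and A: "A = isoclass (induced G I)" and B: "B = isoclass (induced G J)"
    by (rule isoclass_plus_cases)
  have IJ: "I \<union> J = verts G" using sep by (auto simp: separated_def)
  then have "I \<subseteq> verts G" "J \<subseteq> verts G" by auto
  then have "A = 0 \<longleftrightarrow> I = {}" "B = 0 \<longleftrightarrow> J = {}"
    by (simp_all add: A B isoclass_eq_0_iff is_graph_induced[OF G])
  moreover have "A + B = 0 \<longleftrightarrow> verts G = {}"
    by (simp add: A B isoclass_separated[OF G sep, symmetric] isoclass_eq_0_iff[OF G])
  ultimately show ?thesis using IJ by auto
qed

lemma eps_mult: "eps (x * y) = eps x * eps y"
  by (rule linear_form_mult[OF linear_form_eps]) (simp add: eps_bas plus_isograph_eq_0_iff)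

lemma counit_delta_mult: "counit_delta (x * y) = counit_delta x * counit_delta y"
  by (rule linear_form_mult[OF linear_form_counit_delta]) (simp add: counit_delta_bas edgeless_plus)

lemma Delta_cocommutative: "Delta x = lin_ext (\<lambda>(A, B). bas (B, A)) (Delta x)"
  by (rule linear_map_eqI[where x = x, OF linear_map_Delta linear_map_comp[OF linear_map_lin_ext linear_map_Delta]])
    (rule Delta_cocommutative_bas)

lemma form_id_swap: "form_id e (lin_ext (\<lambda>(A, B). bas (B, A)) z) = id_form e z"
proof (rule linear_map_eqI[where x = z])
  show "form_id e (lin_ext (\<lambda>(A, B). bas (B, A)) (bas a)) = id_form e (bas a)" for a
    by (cases a) (simp add: lin_ext_bas form_id_bas id_form_bas)
qed (intro linear_map_intros linear_map_id_form)+

lemma Delta_counit_left: "form_id eps (Delta x) = x"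
proof (rule linear_map_eqI[where x = x])
  fix C
  obtain G :: "nat graph" where G: "is_graph G" and C: "C = isoclass G" by (rule isoclass_cases)
  have fin: "finite (verts G)" using G by (simp add: is_graph_def)
  have "form_id eps (Delta (bas C)) = (\<Sum>I\<in>Pow (verts G).
      scale (eps (bas (isoclass (induced G I)))) (bas (isoclass (induced G (verts G - I)))))"
    by (simp add: C Delta_isoclass_Pow[OF G] linear_map_sum linear_map_form_id form_id_bas)
  also have "\<dots> = (\<Sum>I\<in>{{}}. bas (isoclass (induced G (verts G - I))))"
    by (rule sum.mono_neutral_cong_right)
      (auto simp: fin eps_bas isoclass_eq_0_iff is_graph_induced[OF G] scale_1)
  finally show "form_id eps (Delta (bas C)) = bas C"
    by (simp add: C induced_verts[OF G])
qed (intro linear_map_intros linear_map_Delta)+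

lemma Delta_counit_right: "id_form eps (Delta x) = x"
  using Delta_counit_left[of x] form_id_swap[of eps "Delta x"] Delta_cocommutative[of x] by simp

text \<open>Only the partition into components contracts to an edgeless graph, and cutting along it
  changes nothing.\<close>

lemma delta_counit_left: "form_id counit_delta (delta x) = x"
proof (rule linear_map_eqI[where x = x])
  fix C
  obtain G :: "nat graph" where G: "is_graph G" and C: "C = isoclass G" by (rule isoclass_cases)
  have "form_id counit_delta (delta (bas C)) = (\<Sum>r\<in>admissible G.
      scale (counit_delta (bas (isoclass (contract G r)))) (bas (isoclass (cut G r))))"
    by (simp add: C delta_isoclass_admissible[OF G] linear_map_sum linear_map_form_id form_id_bas)
  also have "\<dots> = (\<Sum>r\<in>{components G}. bas (isoclass (cut G r)))"
    by (rule sum.mono_neutral_cong_right)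
      (auto simp: finite_admissible[OF G] admissible_components[OF G] counit_delta_bas edgeless_isoclass
        is_graph_contract[OF G admissible_equiv] edgeless_contract_iff[OF G] scale_1)
  finally show "form_id counit_delta (delta (bas C)) = bas C"
    by (simp add: C cut_components[OF G])
qed (intro linear_map_intros linear_map_delta)+

text \<open>Only the relation of equality cuts to an edgeless graph, and contracting it changes nothing
  up to isomorphism.\<close>

lemma delta_counit_right: "id_form counit_delta (delta x) = x"
proof (rule linear_map_eqI[where x = x])
  fix C
  obtain G :: "nat graph" where G: "is_graph G" and C: "C = isoclass G" by (rule isoclass_cases)
  have "id_form counit_delta (delta (bas C)) = (\<Sum>r\<in>admissible G.
      scale (counit_delta (bas (isoclass (cut G r)))) (bas (isoclass (contract G r))))"
    by (simp add: C delta_isoclass_admissible[OF G] linear_map_sum linear_map_id_form id_form_bas)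
  also have "\<dots> = (\<Sum>r\<in>{Id_on (verts G)}. bas (isoclass (contract G r)))"
    by (rule sum.mono_neutral_cong_right)
      (auto simp: finite_admissible[OF G] admissible_Id_on[OF G] counit_delta_bas edgeless_isoclass
        is_graph_cut[OF G] edgeless_cut_iff[OF G] scale_1)
  finally show "id_form counit_delta (delta (bas C)) = bas C"
    by (simp add: C isoclass_contract_Id_on[OF G])
qed (intro linear_map_intros linear_map_delta)+

lemma Delta_coassoc: "assoc (tmap Delta id (Delta x)) = tmap id Delta (Delta x)"
  by (rule linear_map_eqI[where x = x])
    (intro linear_map_intros linear_map_Delta | rule Delta_coassoc_bas)+

lemma delta_coassoc: "assoc (tmap delta id (delta x)) = tmap id delta (delta x)"
  by (rule linear_map_eqI[where x = x])
    (intro linear_map_intros linear_map_delta | rule delta_coassoc_bas)+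

lemma eps_1: "eps 1 = 1" and counit_delta_1: "counit_delta 1 = 1"
  using eps_bas[of 0] counit_delta_bas[of 0] by (simp_all add: bas_zero edgeless_0)

lemma bialgebra_Delta: "bialgebra Delta eps"
  by (simp add: bialgebra_def coalgebra_def linear_map_Delta linear_form_eps Delta_coassoc
      Delta_counit_left Delta_counit_right Delta_1 Delta_mult eps_mult eps_1)

lemma bialgebra_delta: "bialgebra delta counit_delta"
  by (simp add: bialgebra_def coalgebra_def linear_map_delta linear_form_counit_delta delta_coassoc
      delta_counit_left delta_counit_right delta_1 delta_mult counit_delta_mult counit_delta_1)

lemma cointeraction: "m_1_3_24 (tmap delta delta (Delta x)) = tmap Delta id (delta x)"
  by (rule linear_map_eqI[where x = x])
    (intro linear_map_intros linear_map_delta linear_map_Delta | rule cointeraction_bas)+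

text \<open>\<open>G/r\<close> is empty only if \<open>G\<close> is, and the empty graph has just the
  empty relation.\<close>

lemma eps_coinvariant: "form_id eps (delta x) = scale (eps x) 1"
proof (rule linear_map_eqI[where x = x])
  fix C
  obtain G :: "nat graph" where G: "is_graph G" and C: "C = isoclass G" by (rule isoclass_cases)
  have "form_id eps (delta (bas C)) = (\<Sum>r\<in>admissible G.
      scale (eps (bas (isoclass (contract G r)))) (bas (isoclass (cut G r))))"
    by (simp add: C delta_isoclass_admissible[OF G] linear_map_sum linear_map_form_id form_id_bas)
  also have "\<dots> = (\<Sum>r\<in>admissible G. if C = 0 then bas (isoclass (cut G r)) else 0)"
    by (intro sum.cong refl) (simp add: C eps_bas isoclass_eq_0_iff G
        is_graph_contract[OF G admissible_equiv] scale_1 quotient_def)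
  also have "\<dots> = scale (eps (bas C)) 1"
  proof (cases "C = 0")
    case True
    then have "verts G = {}" using C isoclass_eq_0_iff[OF G] by simp
    then have cut: "isoclass (cut G r) = 0" for r
      by (simp add: isoclass_eq_0_iff is_graph_cut[OF G])
    have "admissible G = {{}}"
      using \<open>verts G = {}\<close> by (auto simp: admissible_def equiv_def refl_on_def sym_def trans_def)
    then show ?thesis using True eps_bas[of 0] by (simp add: cut scale_1 bas_zero)
  qed (simp add: eps_bas)
  finally show "form_id eps (delta (bas C)) = scale (eps (bas C)) 1" .
qed (intro linear_map_intros linear_map_delta linear_map_form linear_form_eps)+

section \<open>The antipode\<close>

text \<open>The map \<open>m_1_3_24\<close> multiplies the second factors of two coactions; applying the
  convolution product to the remaining first factors gives the product in the tensor product
  algebra.\<close>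

lemma tmap_product:
  assumes "linear_map f" "linear_map g"
  shows "tmap f id u * tmap g id v = tmap (\<lambda>x. mult (tmap f g x)) id (m_1_3_24 (u \<otimes> v))"
proof (rule bilinear_eqI[of "\<lambda>u v. tmap f id u * tmap g id v" "\<lambda>u v. tmap (\<lambda>x. mult (tmap f g x)) id (m_1_3_24 (u \<otimes> v))"])
  fix p q
  show "tmap f id (bas p) * tmap g id (bas q) = tmap (\<lambda>x. mult (tmap f g x)) id (m_1_3_24 (bas p \<otimes> bas q))"
    by (cases p; cases q) (simp add: tensor_bas m_1_3_24_bas tmap_bas tensor_mult mult_tensor bas_mult)
qed (intro linear_map_intros assms linear_map_tmap)+

lemma delta_mult_tmap:
  assumes "comodule_hom delta delta f" "comodule_hom delta delta g"
  shows "delta (mult (tmap f g z)) = tmap (\<lambda>x. mult (tmap f g x)) id (m_1_3_24 (tmap delta delta z))"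
proof (rule linear_map_eqI[where x = z])
  have f: "linear_map f" "\<And>x. delta (f x) = tmap f id (delta x)"
    and g: "linear_map g" "\<And>x. delta (g x) = tmap g id (delta x)"
    using assms by (auto simp: comodule_hom_def)
  fix p
  show "delta (mult (tmap f g (bas p))) = tmap (\<lambda>x. mult (tmap f g x)) id (m_1_3_24 (tmap delta delta (bas p)))"
    by (cases p) (simp add: tmap_bas mult_tensor delta_mult f g tmap_product)
qed (intro linear_map_intros linear_map_delta[THEN linear_map_comp] linear_map_tmap)+

text \<open>Multiplicativity lets \<open>delta\<close> pass through the product, and the cointeraction
  then moves \<open>Delta\<close> past \<open>delta\<close>.\<close>

lemma comodule_hom_convolution:
  assumes "comodule_hom delta delta f" "comodule_hom delta delta g"
  shows "comodule_hom delta delta (\<lambda>x. mult (tmap f g (Delta x)))"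
proof -
  have "delta (mult (tmap f g (Delta x))) = tmap (\<lambda>x. mult (tmap f g (Delta x))) id (delta x)" for x
  proof -
    have 1: "linear_map (\<lambda>x. mult (tmap f g x))" by (intro linear_map_intros linear_map_tmap)
    show ?thesis
      using tmap_comp[OF 1 linear_map_id(1), of Delta id "delta x"]
      by (simp add: delta_mult_tmap[OF assms] cointeraction id_def)
  qed
  then show ?thesis
    unfolding comodule_hom_def by (auto intro!: linear_map_intros linear_map_Delta)
qed

lemma unit_counit_comodule: "delta (scale (eps x) 1) = tmap (\<lambda>x. scale (eps x) 1) id (delta x)"
proof -
  have 1: "linear_map (\<lambda>x. scale (eps x) y)" for y :: HG by (rule linear_map_form[OF linear_form_eps])
  have "tmap (\<lambda>x. scale (eps x) 1) id z = (1 :: HG) \<otimes> form_id eps z" for z :: "(isograph \<times> isograph) free"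
  proof (rule linear_map_eqI[where x = z])
    fix p :: "isograph \<times> isograph"
    show "tmap (\<lambda>x. scale (eps x) 1) id (bas p) = (1 :: HG) \<otimes> form_id eps (bas p)"
      by (cases p) (simp add: tmap_bas form_id_bas
        linear_map_scale[OF linear_map_tensor_left[OF linear_map_id(2)]]
        linear_map_scale[OF linear_map_tensor_right[OF linear_map_id(2)]])
  qed (intro linear_map_intros linear_map_tmap linear_map_form_id)+
  then show ?thesis
    by (simp add: eps_coinvariant linear_map_scale[OF linear_map_delta] delta_1
        linear_map_scale[OF linear_map_tensor_right[OF linear_map_id(2)]])
qed

text \<open>The projection onto the augmentation ideal along the constants.\<close>

definition augmentation :: "HG \<Rightarrow> HG" where
  "augmentation x = x - scale (eps x) 1"

lemma tmap_diff_left: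
  assumes "linear_map f" "linear_map g"
  shows "tmap (\<lambda>x. f x - g x) h z = tmap f h z - tmap g h z"
proof (rule linear_map_eqI[where x = z])
  show "tmap (\<lambda>x. f x - g x) h (bas p) = tmap f h (bas p) - tmap g h (bas p)" for p
    using linear_map_add[OF linear_map_tensor_left[OF linear_map_id(2)], of "f (bas (fst p)) - g (bas (fst p))" "g (bas (fst p))" "h (bas (snd p))"]
    by (cases p) (simp add: tmap_bas)
qed (intro linear_map_intros linear_map_tmap)+

lemma comodule_hom_augmentation: "comodule_hom delta delta augmentation"
proof -
  have l: "linear_map augmentation"
    unfolding augmentation_def
    by (intro linear_map_intros linear_map_form linear_form_eps)
  have "delta (augmentation x) = tmap augmentation id (delta x)" for x
  proof -
    have "delta (augmentation x) = delta x - delta (scale (eps x) 1)"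
      using linear_map_add[OF linear_map_delta, of "augmentation x" "scale (eps x) 1"]
      by (simp add: augmentation_def)
    also have "\<dots> = tmap augmentation id (delta x)"
      unfolding unit_counit_comodule augmentation_def
      by (subst tmap_diff_left)
        (simp_all add: linear_map_id linear_map_form linear_form_eps tmap_ident[unfolded id_def] id_def)
    finally show ?thesis .
  qed
  then show ?thesis using l by (simp add: comodule_hom_def)
qed

text \<open>The powers of \<open>augmentation\<close> for the convolution product, whose unit is the
  composite of counit and unit.\<close>

primrec conv_power :: "nat \<Rightarrow> HG \<Rightarrow> HG" where
  "conv_power 0 x = scale (eps x) 1"
| "conv_power (Suc k) x = mult (tmap (conv_power k) augmentation (Delta x))"

lemma comodule_hom_conv_power: "comodule_hom delta delta (conv_power k)"
proof (induction k)
  case 0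
  then show ?case
    by (simp add: comodule_hom_def unit_counit_comodule linear_map_form linear_form_eps
      conv_power.simps(1)[abs_def])
next
  case (Suc k)
  then show ?case
    using comodule_hom_convolution[OF Suc comodule_hom_augmentation] by (simp add: conv_power.simps(2)[abs_def])
qed

lift_definition isograph_order :: "isograph \<Rightarrow> nat" is "\<lambda>G. card (verts G)"
  by (auto simp: isomorphic_def iso_by_def bij_betw_same_card)

lemma isograph_order_isoclass:
  assumes "is_graph G"
  shows "isograph_order (isoclass G) = card (verts G)"
proof -
  obtain H where H: "is_graph H" "isomorphic G H" "isoclass G = abs_isograph H"
    using isoclass_ex[OF assms] by blast
  have "isograph_order (isoclass G) = card (verts H)"
    using isograph_order.abs_eq[of H] H(1,3) by (simp add: isomorphic_refl)
  then show ?thesis using H(2) by (auto simp: isomorphic_def iso_by_def bij_betw_same_card)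
qed

lemma augmentation_bas: "augmentation (bas C) = (if C = 0 then 0 else bas C)"
  by (simp add: augmentation_def eps_bas scale_1 bas_zero)

lemma convolution_isoclass:
  assumes "is_graph G"
  shows "mult (tmap f g (Delta (bas (isoclass G)))) = (\<Sum>I\<in>Pow (verts G).
    f (bas (isoclass (induced G I))) * g (bas (isoclass (induced G (verts G - I)))))"
  by (simp add: Delta_isoclass_Pow[OF assms] linear_map_sum linear_map_tmap linear_map_mult tmap_bas mult_tensor)

text \<open>Each factor takes a nonempty part of the vertices, so \<open>k\<close> factors need at least
  \<open>k\<close> vertices.\<close>

lemma conv_power_eq_0:
  assumes "isograph_order C < k"
  shows "conv_power k (bas C) = 0"
  using assms
proof (induction k arbitrary: C)
  case (Suc k)
  obtain G :: "nat graph" where G: "is_graph G" and C: "C = isoclass G" by (rule isoclass_cases)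
  have fin: "finite (verts G)" using G by (simp add: is_graph_def)
  have "conv_power k (bas (isoclass (induced G I))) *
      augmentation (bas (isoclass (induced G (verts G - I)))) = 0" if I: "I \<subseteq> verts G" for I
  proof (cases "I = verts G")
    case True
    then show ?thesis by (simp add: augmentation_bas isoclass_eq_0_iff is_graph_induced[OF G])
  next
    case False
    then have "card I < card (verts G)" using I fin by (simp add: psubset_card_mono psubset_eq)
    then have "isograph_order (isoclass (induced G I)) < k"
      using Suc.prems by (simp add: C isograph_order_isoclass G is_graph_induced[OF G I])
    then show ?thesis using Suc.IH by simp
  qed
  then show ?case by (simp add: C convolution_isoclass[OF G])
qed simp

text \<open>The identity is the convolution unit plus \<open>augmentation\<close>, so its convolution
  inverse is the geometric series in minus \<open>augmentation\<close>. The upper summation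
  bound loses nothing because the higher powers vanish.\<close>

definition antipode_Delta :: "HG \<Rightarrow> HG" where
  "antipode_Delta = lin_ext (\<lambda>C. \<Sum>k\<le>isograph_order C. scale ((- 1) ^ k) (conv_power k (bas C)))"

text \<open>A bound \<open>N\<close> common to several isoclasses lets the sum over powers be exchanged
  with sums over subgraphs or relations.\<close>

lemma antipode_Delta_bas:
  assumes "isograph_order C \<le> N"
  shows "antipode_Delta (bas C) = (\<Sum>k\<le>N. scale ((- 1) ^ k) (conv_power k (bas C)))"
  unfolding antipode_Delta_def lin_ext_bas
  by (rule sum.mono_neutral_left) (use assms in \<open>auto simp: conv_power_eq_0\<close>)

lemma convolution_id:
  assumes "linear_map f"
  shows "mult (tmap f id (Delta x)) = mult (tmap f augmentation (Delta x)) + f x"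
proof -
  have "mult (tmap f id z) = mult (tmap f augmentation z) + f (id_form eps z)" for z
  proof (rule linear_map_eqI[where x = z])
    fix p :: "isograph \<times> isograph"
    show "mult (tmap f id (bas p)) = mult (tmap f augmentation (bas p)) + f (id_form eps (bas p))"
      by (cases p) (simp add: tmap_bas mult_tensor id_form_bas augmentation_def algebra_simps
          scale_mult_right linear_map_scale[OF assms])
  qed (intro linear_map_intros linear_map_tmap linear_map_comp[OF assms] linear_map_id_form)+
  then show ?thesis by (simp add: Delta_counit_right)
qed

text \<open>Convolving with the identity adds to each power the next one
  (\<open>convolution_id\<close>), so the alternating sum telescopes.\<close>

lemma antipode_left: "mult (tmap antipode_Delta id (Delta x)) = scale (eps x) 1"
proof (rule linear_map_eqI[where x = x])
  fix C
  obtain G :: "nat graph" where G: "is_graph G" and C: "C = isoclass G" by (rule isoclass_cases)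
  let ?V = "verts G" and ?b = "\<lambda>I. bas (isoclass (induced G I))" and ?N = "card (verts G)"
  let ?s = "\<lambda>k x. scale ((- 1) ^ k) (conv_power k x)"
  have fin: "finite ?V" using G by (simp add: is_graph_def)
  have S: "antipode_Delta (?b I) = (\<Sum>k\<le>?N. ?s k (?b I))" if "I \<subseteq> ?V" for I
    using that by (intro antipode_Delta_bas)
      (simp add: isograph_order_isoclass is_graph_induced[OF G] card_mono[OF fin])
  have lin: "linear_map (conv_power k)" for k
    using comodule_hom_conv_power by (simp add: comodule_hom_def)
  have "mult (tmap antipode_Delta id (Delta (bas C))) =
      (\<Sum>I\<in>Pow ?V. \<Sum>k\<le>?N. ?s k (?b I) * ?b (?V - I))"
    by (simp add: C convolution_isoclass[OF G] S sum_distrib_right)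
  also have "\<dots> = (\<Sum>k\<le>?N. \<Sum>I\<in>Pow ?V. ?s k (?b I) * ?b (?V - I))"
    by (rule sum.swap)
  also have "\<dots> = (\<Sum>k\<le>?N. scale ((- 1) ^ k) (mult (tmap (conv_power k) id (Delta (bas C)))))"
    by (simp add: C convolution_isoclass[OF G] scale_mult_left
        linear_map_sum[OF linear_map_scale_fun[OF linear_map_id(2)]])
  also have "\<dots> = (\<Sum>k\<le>?N. ?s k (bas C) - ?s (Suc k) (bas C))"
  proof (rule sum.cong[OF refl])
    fix k
    have "scale (- 1 * (- 1) ^ k) y = - scale ((- 1) ^ k) y" for y :: HG
      by (rule poly_mapping_eqI) simp
    then show "scale ((- 1) ^ k) (mult (tmap (conv_power k) id (Delta (bas C)))) =
        ?s k (bas C) - ?s (Suc k) (bas C)"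
      by (simp add: convolution_id[OF lin] scale_right_distrib)
  qed
  also have "\<dots> = ?s 0 (bas C) - ?s (Suc ?N) (bas C)"
    by (rule sum_telescope)
  also have "\<dots> = scale (eps (bas C)) 1"
    using conv_power_eq_0[of C "Suc ?N"]
    by (simp add: scale_1 C isograph_order_isoclass[OF G] del: conv_power.simps(2))
  finally show "mult (tmap antipode_Delta id (Delta (bas C))) = scale (eps (bas C)) 1" .
qed (intro linear_map_intros linear_map_Delta linear_map_form linear_form_eps)+

lemma mult_tmap_swap: "mult (tmap f g (lin_ext (\<lambda>(A, B). bas (B, A)) z)) = mult (tmap g f z)"
proof (rule linear_map_eqI[where x = z])
  show "mult (tmap f g (lin_ext (\<lambda>(A, B). bas (B, A)) (bas p))) = mult (tmap g f (bas p))" for p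
    by (cases p) (simp add: lin_ext_bas tmap_bas mult_tensor mult.commute)
qed (intro linear_map_intros linear_map_tmap)+

text \<open>\<open>Delta\<close> is cocommutative and the product commutative, so the left inverse is
  also a right inverse.\<close>

lemma antipode_antipode_Delta: "antipode Delta eps antipode_Delta"
  using antipode_left mult_tmap_swap[of id antipode_Delta "Delta _"] Delta_cocommutative
  by (simp add: antipode_def antipode_Delta_def linear_map_lin_ext)

text \<open>Contraction does not increase the number of vertices, so one bound on the powers serves
  \<open>G\<close> and all its contractions, and the claim follows from that for each power.\<close>

lemma comodule_hom_antipode_Delta: "comodule_hom delta delta antipode_Delta"
proof -
  have lin: "linear_map antipode_Delta" by (simp add: antipode_Delta_def linear_map_lin_ext)
  have "delta (antipode_Delta x) = tmap antipode_Delta id (delta x)" for x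
  proof (rule linear_map_eqI[where x = x])
    fix C
    obtain G :: "nat graph" where G: "is_graph G" and C: "C = isoclass G" by (rule isoclass_cases)
    let ?N = "card (verts G)"
    let ?s = "\<lambda>k x. scale ((- 1) ^ k) (conv_power k x)"
    have fin: "finite (verts G)" using G by (simp add: is_graph_def)
    have S: "antipode_Delta (bas (isoclass (contract G r))) =
        (\<Sum>k\<le>?N. ?s k (bas (isoclass (contract G r))))" if "r \<in> admissible G" for r
    proof (rule antipode_Delta_bas)
      have "card (verts G // r) \<le> card (verts G)"
        unfolding quotient_def UNION_singleton_eq_range by (rule card_image_le[OF fin])
      then show "isograph_order (isoclass (contract G r)) \<le> ?N"
        by (simp add: isograph_order_isoclass is_graph_contract[OF G admissible_equiv[OF that]])
    qed
    have com: "delta (conv_power k x) = tmap (conv_power k) id (delta x)" for k x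
      using comodule_hom_conv_power by (simp add: comodule_hom_def)
    have "delta (antipode_Delta (bas C)) =
        (\<Sum>k\<le>?N. scale ((- 1) ^ k) (tmap (conv_power k) id (delta (bas C))))"
      by (simp add: C antipode_Delta_bas[OF order_refl] isograph_order_isoclass[OF G]
          linear_map_sum[OF linear_map_delta] linear_map_scale[OF linear_map_delta] com)
    also have "\<dots> = (\<Sum>k\<le>?N. \<Sum>r\<in>admissible G.
        ?s k (bas (isoclass (contract G r))) \<otimes> bas (isoclass (cut G r)))"
      by (simp add: C delta_isoclass_admissible[OF G] linear_map_sum[OF linear_map_tmap] tmap_bas
          linear_map_sum[OF linear_map_scale_fun[OF linear_map_id(2)]]
          linear_map_scale[OF linear_map_tensor_left[OF linear_map_id(2)]])
    also have "\<dots> = (\<Sum>r\<in>admissible G. \<Sum>k\<le>?N.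
        ?s k (bas (isoclass (contract G r))) \<otimes> bas (isoclass (cut G r)))"
      by (rule sum.swap)
    also have "\<dots> = tmap antipode_Delta id (delta (bas C))"
      by (simp add: C delta_isoclass_admissible[OF G] linear_map_sum[OF linear_map_tmap] tmap_bas S
          linear_map_sum[OF linear_map_tensor_left[OF linear_map_id(2)]])
    finally show "delta (antipode_Delta (bas C)) = tmap antipode_Delta id (delta (bas C))" .
  qed (intro linear_map_intros linear_map_comp[OF linear_map_delta lin] linear_map_delta)+
  then show ?thesis using lin by (simp add: comodule_hom_def)
qed

section \<open>The structure maps as comodule morphisms\<close>

lemma comodule_hom_unit: "comodule_hom trivial_coaction delta unit_map"
proof -
  have l: "linear_map (unit_map :: unit free \<Rightarrow> HG)"
    by (rule linear_mapI) (simp_all add: unit_map_def lookup_add scale_left_distrib scale_scale)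
  have "delta (unit_map x) = tmap unit_map id (trivial_coaction x)" for x
    using tmap_tensor[OF l linear_map_id(1), of x "1 :: HG"]
    by (simp add: trivial_coaction_def unit_map_def linear_map_scale[OF linear_map_delta] delta_1
        linear_map_scale[OF linear_map_tensor_left[OF linear_map_id(2)]])
  then show ?thesis using l by (simp add: comodule_hom_def)
qed

lemma comodule_hom_mult: "comodule_hom (tensor_coaction delta delta) delta mult"
proof -
  have "comodule_hom delta delta id"
    by (simp add: comodule_hom_def linear_map_id tmap_ident)
  from delta_mult_tmap[OF this this] show ?thesis
    by (simp add: comodule_hom_def linear_map_mult tmap_ident tensor_coaction_def)
qed

lemma comodule_hom_counit: "comodule_hom delta trivial_coaction (counit_map eps)"
proof -
  have l: "linear_map (counit_map eps)"
    using linear_map_form[OF linear_form_eps] by (simp add: counit_map_def[abs_def])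
  have "tmap (counit_map eps) id z = bas () \<otimes> form_id eps z" for z :: "(isograph \<times> isograph) free"
  proof (rule linear_map_eqI[where x = z])
    fix p :: "isograph \<times> isograph"
    show "tmap (counit_map eps) id (bas p) = bas () \<otimes> form_id eps (bas p)"
      by (cases p) (simp add: tmap_bas form_id_bas counit_map_def
        linear_map_scale[OF linear_map_tensor_left[OF linear_map_id(2)]]
        linear_map_scale[OF linear_map_tensor_right[OF linear_map_id(2)]])
  qed (intro linear_map_intros linear_map_tmap linear_map_form_id)+
  then have "trivial_coaction (counit_map eps x) = tmap (counit_map eps) id (delta x)" for x
    by (simp add: trivial_coaction_def counit_map_def eps_coinvariant
        linear_map_scale[OF linear_map_tensor_left[OF linear_map_id(2)]]
        linear_map_scale[OF linear_map_tensor_right[OF linear_map_id(2)]])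
  then show ?thesis using l by (simp add: comodule_hom_def)
qed

lemma comodule_hom_Delta: "comodule_hom delta (tensor_coaction delta delta) Delta"
  by (simp add: comodule_hom_def tensor_coaction_def cointeraction linear_map_Delta)

theorem theorem1p7:
  shows "(\<exists>e'. hopf_algebra_in_comodules delta e' delta Delta eps) \<and>
    delta 1 = 1 \<otimes> 1 \<and>
    m_1_3_24 \<circ> tmap delta delta \<circ> Delta = tmap Delta id \<circ> delta \<and>
    (\<forall>a b. delta (a * b) = delta a * delta b) \<and>
    (\<forall>a. form_id eps (delta a) = scale (eps a) 1)"
proof (intro conjI allI exI[of _ counit_delta])
  have "comodule delta counit_delta delta"
    by (simp add: comodule_def linear_map_delta delta_coassoc delta_counit_right)
  then show "hopf_algebra_in_comodules delta counit_delta delta Delta eps"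
    unfolding hopf_algebra_in_comodules_def
    using bialgebra_delta bialgebra_Delta comodule_hom_unit comodule_hom_mult comodule_hom_counit
      comodule_hom_Delta antipode_antipode_Delta comodule_hom_antipode_Delta by blast
qed (simp_all add: delta_1 delta_mult eps_coinvariant cointeraction fun_eq_iff)

end
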